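(* The sorting algorithm MergeInsertion needs $n\log n - c(n)\cdot n + O(\log n)$ comparisons on average to sort $n$ elements, where $c(n)\ge 1.3999$.
   Context: All logarithms are to base 2; the average is over the uniform distribution on all orderings of $n$ pairwise distinct elements, counting element comparisons. MergeInsertion (Ford–Johnson) on $n$ elements: (1) Group the elements into $\lfloor n/2\rfloor$ pairs and compare within each pair (one comparison per pair), calling the larger element of the $i$-th pair $a_i$ and the smaller $b_i$; if $n$ is odd, one element $b$ remains unpaired. (2) Sort the elements $a_i$ recursively with MergeInsertion; relabel so that $a_1<a_2<\dots<a_{\lfloor n/2\rfloor}$ and $b_i$ is the partner of $a_i$ (and the unpaired element, if any, is $b_{\lceil n/2\rceil}$). (3) The main chain is $b_1<a_1<\dots<a_{\lfloor n/2\rfloor}$; insert the remaining $b_i$ into the main chain by binary insertion, where $b_i$ ($i\le\lfloor n/2\rfloor$) is inserted among the main-chain elements smaller than $a_i$ (the unpaired element among all), in the order $b_3,b_2;\ b_5,b_4;\ b_{11},\dots,b_6;\ \dots;\ b_{t_k},b_{t_k-1},\dots,b_{t_{k-1}+1};\dots$, where $t_k=(2^{k+1}+(-1)^k)/3$ (indices exceeding the number of $b$'s are skipped, the last group being inserted starting from the largest existing index). In the analyzed (basic) variant, each element of the $k$-th group $b_{t_k},\dots,b_{t_{k-1}+1}$ is inserted by binary search over a range of at most $2^k-1$ main-chain elements, so using at most $k$ comparisons. *)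

theory Defs
  imports Complex_Main "HOL-Combinatorics.Multiset_Permutations" "HOL-Library.Landau_Symbols"
begin

function binsert :: "'a::linorder \<Rightarrow> 'a list \<Rightarrow> 'a list \<times> nat" where
  "binsert x ys =
     (if ys = [] then ([x], 0)
      else (let j = length ys div 2 in
            if x < ys ! j then
              (case binsert x (take j ys) of (zs, c) \<Rightarrow> (zs @ drop j ys, Suc c))
            else
              (case binsert x (drop (Suc j) ys) of (zs, c) \<Rightarrow> (take (Suc j) ys @ zs, Suc c))))"
  by pat_completeness auto
termination
  by (relation "measure (\<lambda>(x, ys). length ys)") auto

definition tJ :: "nat \<Rightarrow> nat" where
  "tJ k = (if even k then (2 ^ (k + 1) + 1) div 3 else (2 ^ (k + 1) - 1) div 3)"

text \<open>Order in which b_2, ..., b_N are inserted: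
  b_3, b_2; b_5, b_4; b_11, ..., b_6; ...; indices exceeding N are skipped.\<close>
definition ins_order :: "nat \<Rightarrow> nat list" where
  "ins_order N = concat (map (\<lambda>k. rev [tJ (k - 1) + 1 ..< Suc (min (tJ k) N)]) [2 ..< N + 2])"

function merge_insertion :: "'a::linorder list \<Rightarrow> 'a list \<times> nat" where
  "merge_insertion xs =
    (if length xs \<le> 1 then (xs, 0) else
     (let m = length xs div 2;
          prs = map (\<lambda>i. (max (xs ! (2 * i)) (xs ! (2 * i + 1)),
                           min (xs ! (2 * i)) (xs ! (2 * i + 1)))) [0 ..< m]
      in case merge_insertion (map fst prs) of (as, c_rec) \<Rightarrow>
       (let bs = map (\<lambda>a. the (map_of prs a)) as;
            B = bs @ (if odd (length xs) then [last xs] else []);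
            step = (\<lambda>(ch, c) i.
                      let rng = (if i \<le> m then takeWhile (\<lambda>z. z \<noteq> as ! (i - 1)) ch
                                 else ch)
                      in case binsert (B ! (i - 1)) rng of
                           (r, c') \<Rightarrow> (r @ drop (length rng) ch, c + c'));
            res = foldl step (hd B # as, 0) (ins_order (length B))
        in (fst res, m + c_rec + snd res))))"
  by pat_completeness auto
termination
  by (relation "measure length") auto

definition avg_comparisons_MI :: "nat \<Rightarrow> real" where
  "avg_comparisons_MI n =
     (\<Sum>xs\<in>permutations_of_set {0..<n}. real (snd (merge_insertion xs)))
       / real (card (permutations_of_set {0..<(n::nat)}))"

end

theory Submission
  imports Defs "HOL-Real_Asymp.Real_Asymp"
begin

text \<open>
  Only an upper bound on the average is needed, since \<open>c\<close> may absorb any further saving. Let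
  \<open>N\<close> be the number of \<open>b\<close>'s, \<open>k\<close> the index of the last group and \<open>t = tJ (k - 1)\<close>. An element of an
  earlier group \<open>j\<close> costs at most \<open>j\<close> comparisons. An element of the last group is inserted into a
  chain with \<open>s \<le> N + t \<le> 2 ^ k\<close> gaps. Exchanging its value with that of its
  predecessor in the chain shows that, for fixed \<open>s\<close>, its gap distribution is decreasing from left to
  right. The \<open>2 ^ k - s\<close> gaps which cost only \<open>k - 1\<close> comparisons are spread evenly over the chain up to
  an error of \<open>k\<close>, so Abel summation bounds the expected cost by
  \<open>k + 1 - 2 ^ k / s\<close> plus \<open>k\<close> times the probability of the leftmost gap, and exchanging values with
  \<open>b\<^sub>1, ..., b\<^sub>t\<close> shows that the latter is at most \<open>1 / t\<close>. Summing over one insertion phase gives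
  \<open>N log N + N - (log z + 12 / (3 z + 2) - 1) N + O(log\<^sup>2 N)\<close> with \<open>z = 2 N / 2 ^ k\<close>, and the
  parenthesis is at least 1.39995. The surplus over 1.3999 swallows all lower order terms.
\<close>

subsection \<open>Cost of a binary insertion\<close>

text \<open>Only the last group is averaged because this method gains nothing elsewhere: a complete
  group \<open>j\<close> allows up to \<open>2 ^ j\<close> gaps, and for that many gaps the averaged
  bound is no better than the worst case \<open>j\<close>. The obstacle is that the number of gaps
  is random: an element of the same group that was inserted earlier may lie above \<open>a_i\<close>
  or below it. Its law is never computed. The exchange with the predecessor keeps the size of the
  range, so monotonicity holds for each size separately; and since \<open>k + 1 - 2 ^ k / s\<close>
  grows with \<open>s\<close>, the largest possible \<open>s\<close> covers all sizes. The function
  of \<open>z\<close> comes from putting \<open>t = 2 ^ k / 3\<close> up to rounding. Relative to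
  \<open>N (k + 1)\<close>, the saving in the last group and the smaller cost of the earlier groups
  add up to \<open>12 / (3 z + 2)\<close> per element, and \<open>log z = 1 + log N - k\<close>
  eliminates \<open>k\<close>. If a phase costs \<open>N log N - d N\<close> with \<open>N\<close>
  about \<open>n / 2\<close>, the recurrence over halves turns this into
  \<open>n log n - (1 + d) n\<close>; hence \<open>d = 0.39995\<close> is what has to be
  reached.\<close>

text \<open>Number of comparisons \<open>binsert\<close> makes on a list with \<open>s\<close> gaps, i.e. of length \<open>s - 1\<close>,
  if the new element belongs into gap \<open>p\<close>.\<close>
function bcost :: "nat \<Rightarrow> nat \<Rightarrow> nat" where
  "bcost s p =
     (if s \<le> 1 then 0
      else Suc (if p < (s + 1) div 2 then bcost ((s + 1) div 2) p
                else bcost (s div 2) (p - (s + 1) div 2)))"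
  by pat_completeness auto
termination
  by (relation "measure fst") auto

declare bcost.simps [simp del] binsert.simps [simp del]

lemma bcost_le: "s \<le> 2 ^ k \<Longrightarrow> bcost s p \<le> k"
proof (induction k arbitrary: s p)
  case 0
  then show ?case by (simp add: bcost.simps)
next
  case (Suc k)
  have "(s + 1) div 2 \<le> 2 ^ k" "s div 2 \<le> 2 ^ k" using Suc.prems by auto
  then show ?case
    using Suc.IH by (subst bcost.simps) auto
qed

text \<open>This is the external path length of a balanced search tree: \<open>2 ^ k - s\<close>
  leaves have depth \<open>k - 1\<close>, the others depth \<open>k\<close>. Both halves at the root
  satisfy the hypotheses with \<open>k - 1\<close>, so the formula adds up.\<close>

lemma sum_bcost:
  assumes "2 ^ k \<le> 2 * s" "s \<le> 2 ^ k"
  shows "(\<Sum>p<s. real (bcost s p)) = real s * (real k + 1) - 2 ^ k"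
  using assms
proof (induction k arbitrary: s)
  case 0
  then have "s = 1" by auto
  then show ?case by (simp add: bcost.simps)
next
  case (Suc k)
  show ?case
  \<comment> \<open>One gap fits the hypotheses for exponent 1 as well as for exponent 0, but there
    is no root at which to split.\<close>
  proof (cases "s = 1")
    case True
    have "k = 0"
    proof (rule ccontr)
      assume "k \<noteq> 0"
      then have "(2::nat) ^ 1 \<le> 2 ^ k" by (intro power_increasing) auto
      then show False using Suc.prems True by simp
    qed
    with True show ?thesis by (simp add: bcost.simps)
  next
    case False
    with Suc.prems have s2: "s \<ge> 2" by (cases s) auto
    define l where "l = (s + 1) div 2"
    define r where "r = s div 2"
    have lr: "l + r = s" using s2 by (auto simp: l_def r_def)
    have l: "2 ^ k \<le> 2 * l" "l \<le> 2 ^ k" and r: "2 ^ k \<le> 2 * r" "r \<le> 2 ^ k"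
      using Suc.prems s2 by (cases k; auto simp: l_def r_def)+
    have left: "bcost s p = Suc (bcost l p)" if "p < l" for p
      using that s2 by (subst bcost.simps) (simp add: l_def)
    have right: "bcost s (l + p) = Suc (bcost r p)" for p
      using s2 by (subst bcost.simps) (simp add: l_def r_def)
    have "(\<Sum>p<l + n. real (bcost s p)) =
        (\<Sum>p<l. real (bcost s p)) + (\<Sum>p<n. real (bcost s (l + p)))" for n
      by (induction n) (auto simp: algebra_simps)
    from this[of r] have "(\<Sum>p<s. real (bcost s p)) =
        (\<Sum>p<l. real (bcost s p)) + (\<Sum>p<r. real (bcost s (l + p)))"
      by (simp add: lr)
    also have "\<dots> = real l + real r + (\<Sum>p<l. real (bcost l p)) + (\<Sum>p<r. real (bcost r p))"
      by (simp add: left right sum.distrib)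
    also have "\<dots> = real s * (real (Suc k) + 1) - 2 ^ Suc k"
      unfolding Suc.IH[OF l] Suc.IH[OF r] lr[symmetric] by (simp add: algebra_simps)
    finally show ?thesis .
  qed
qed

text \<open>The first term is what \<open>q\<close> gaps would cost at the mean over all
  \<open>s\<close> gaps. The two halves at a node differ in size by at most one, so their mean costs
  nearly agree and each level of the recursion contributes an error of at most 1.\<close>

lemma sum_bcost_prefix_le:
  assumes "2 ^ k \<le> 2 * s" "s \<le> 2 ^ k" "q \<le> s"
  shows "(\<Sum>p<q. real (bcost s p)) \<le> real q * (real k + 1 - 2 ^ k / real s) + real k"
  using assms
proof (induction k arbitrary: s q)
  case 0
  then have "s = 1" by auto
  then show ?case by (simp add: bcost.simps)
next
  case (Suc k)
  show ?case
  proof (cases "s = 1")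
    case True
    have "k = 0"
    proof (rule ccontr)
      assume "k \<noteq> 0"
      then have "(2::nat) ^ 1 \<le> 2 ^ k" by (intro power_increasing) auto
      then show False using Suc.prems True by simp
    qed
    with True show ?thesis by (simp add: bcost.simps)
  next
    case False
    with Suc.prems have s2: "s \<ge> 2" by (cases s) auto
    define l where "l = (s + 1) div 2"
    define r where "r = s div 2"
    have lr: "l + r = s" "r \<ge> 1" "l \<ge> 1" "l = r \<or> l = r + 1"
      using s2 by (auto simp: l_def r_def)
    have l: "2 ^ k \<le> 2 * l" "l \<le> 2 ^ k" and r: "2 ^ k \<le> 2 * r" "r \<le> 2 ^ k"
      using Suc.prems s2 by (cases k; auto simp: l_def r_def)+
    have left: "bcost s p = Suc (bcost l p)" if "p < l" for p
      using that s2 by (subst bcost.simps) (simp add: l_def)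
    have right: "bcost s (l + p) = Suc (bcost r p)" for p
      using s2 by (subst bcost.simps) (simp add: l_def r_def)
    define K where "K = (2::real) ^ k"
    have K: "K \<le> 2 * real l" "real l \<le> K" "K \<le> 2 * real r" "real r \<le> K"
      using l r unfolding K_def
      by (metis of_nat_le_iff of_nat_mult of_nat_numeral of_nat_power)+
    have Ks: "K \<le> real s" using Suc.prems(1) unfolding K_def
      by (metis mult_le_cancel1 numeral_power_le_of_nat_cancel_iff power_Suc zero_less_numeral)
    have Kpos: "K > 0" by (simp add: K_def)
    have rs: "real s = real l + real r" using lr by linarith
    show ?thesis
    proof (cases "q \<le> l")
      case True
      have "(\<Sum>p<q. real (bcost s p)) = (\<Sum>p<q. 1 + real (bcost l p))"
        using True by (intro sum.cong) (auto simp: left)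
      also have "\<dots> = real q + (\<Sum>p<q. real (bcost l p))"
        by (simp add: sum.distrib)
      also have "\<dots> \<le> real q + (real q * (real k + 1 - K / real l) + real k)"
        using Suc.IH[OF l True] by (simp add: K_def)
      also have "\<dots> \<le> real q * (real (Suc k) + 1 - 2 * K / real s) + real (Suc k)"
      proof -
        have "real q * (2 * K / real s - K / real l) \<le> 1"
        proof (cases "l = r")
          case True
          then have "2 * K / real s - K / real l = 0" unfolding rs by simp
          then show ?thesis by (simp only:)
        next
          case False
          then have sl: "real s = 2 * real l - 1" using lr rs by auto
          have spos: "real s > 0" using s2 by simp
          \<comment> \<open>The mean saving in the larger half differs from that of the whole by
            this amount; multiplied by \<open>q \<le> l\<close> it stays below 1 because
            \<open>K \<le> s\<close>.\<close>
          have "2 * K / real s - K / real l = K / (real s * real l)"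
            using spos lr unfolding sl by (simp add: field_simps)
          then have "real q * (2 * K / real s - K / real l) = (real q / real l) * (K / real s)"
            by simp
          also have "\<dots> \<le> 1 * 1"
            using True Ks spos Kpos lr by (intro mult_mono) auto
          finally show ?thesis by simp
        qed
        then show ?thesis by (simp add: algebra_simps)
      qed
      finally show ?thesis by (simp add: K_def)
    next
      case False
      define q' where "q' = q - l"
      have q': "q = l + q'" "q' \<le> r" using False Suc.prems lr by (auto simp: q'_def)
      have rq: "real q = real l + real q'" using q' by simp
      have split: "(\<Sum>p<q. real (bcost s p)) =
            (\<Sum>p<l. real (bcost s p)) + (\<Sum>p<q'. real (bcost s (l + p)))"
        unfolding q' by (induction q') (auto simp: algebra_simps)
      have "(\<Sum>p<l. real (bcost s p)) = real l + (\<Sum>p<l. real (bcost l p))"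
        by (simp add: left sum.distrib)
      moreover have "(\<Sum>p<q'. real (bcost s (l + p))) = real q' + (\<Sum>p<q'. real (bcost r p))"
        by (simp add: right sum.distrib)
      moreover have "(\<Sum>p<l. real (bcost l p)) = real l * (real k + 1) - K"
        using sum_bcost[OF l] by (simp add: K_def)
      moreover have "(\<Sum>p<q'. real (bcost r p)) \<le> real q' * (real k + 1 - K / real r) + real k"
        using Suc.IH[OF r q'(2)] by (simp add: K_def)
      ultimately have "(\<Sum>p<q. real (bcost s p))
          \<le> real q * (real k + 2) + real k - K - K * real q' / real r"
        unfolding split rq by (simp add: algebra_simps)
      also have "\<dots> \<le> real q * (real (Suc k) + 1 - 2 * K / real s) + real (Suc k)"
      proof -
        have "2 * K * real q / real s - K - K * real q' / real r \<le> 1"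
        proof (cases "l = r")
          case True
          have "2 * K * real q / real s - K - K * real q' / real r = 0"
            using lr unfolding rs rq True by (simp add: field_simps)
          then show ?thesis by (simp only:)
        next
          case False
          then have ll: "real l = real r + 1" and ss: "real s = 2 * real r + 1"
            using lr rs by auto
          have rpos: "real r > 0" and spos: "real s > 0" using lr s2 by auto
          have "2 * K * real q / real s - K - K * real q' / real r
              = (K / real s) * (1 - real q' / real r)"
            using ll rpos unfolding q' ss by (simp add: field_simps)
          also have "\<dots> \<le> 1 * 1"
            using q' Ks spos Kpos rpos by (intro mult_mono) auto
          finally show ?thesis by simp
        qed
        then show ?thesis by (simp add: algebra_simps)
      qed
      finally show ?thesis by (simp add: K_def)
    qed
  qed
qed

section \<open>Expected cost under an antitone gap distribution\<close>

lemma antitone_weighted_sum_le: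
  fixes w c :: "nat \<Rightarrow> real"
  assumes anti: "\<And>p. Suc p < n \<Longrightarrow> w (Suc p) \<le> w p"
    and nonneg: "\<And>p. p < n \<Longrightarrow> w p \<ge> 0"
    and prefix: "\<And>q. q \<le> n \<Longrightarrow> (\<Sum>p<q. c p) \<le> E" and "n > 0"
  shows "(\<Sum>p<n. w p * c p) \<le> E * w 0"
proof -
  have "(\<Sum>p<Suc i. w p * c p) \<le> w i * (\<Sum>p<Suc i. c p) + E * (w 0 - w i)" if "i < n" for i
    using that
  proof (induction i)
    case (Suc i)
    have "(w i - w (Suc i)) * (\<Sum>p<Suc i. c p) \<le> (w i - w (Suc i)) * E"
      using Suc.prems anti[of i] prefix[of "Suc i"] by (intro mult_left_mono) linarith+
    then show ?case using Suc by (simp add: algebra_simps)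
  qed simp
  from this[of "n - 1"] have "(\<Sum>p<n. w p * c p)
      \<le> w (n - 1) * (\<Sum>p<n. c p) + E * (w 0 - w (n - 1))"
    using \<open>n > 0\<close> by simp
  also have "\<dots> \<le> w (n - 1) * E + E * (w 0 - w (n - 1))"
    using nonneg prefix \<open>n > 0\<close> by (intro add_right_mono mult_left_mono) auto
  finally show ?thesis by (simp add: algebra_simps)
qed

text \<open>Abel summation is applied to the cost minus its mean over all gaps. The centred cost has
  prefix sums of at most \<open>k\<close>, so an antitone weight can exceed the uniform average only
  by \<open>k * w 0\<close>.\<close>

lemma antitone_weighted_bcost_le:
  fixes w :: "nat \<Rightarrow> real"
  assumes "\<And>p. Suc p < s \<Longrightarrow> w (Suc p) \<le> w p" and "\<And>p. p < s \<Longrightarrow> w p \<ge> 0"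
    and s: "2 ^ k \<le> 2 * s" "s \<le> 2 ^ k"
  shows "(\<Sum>p<s. w p * real (bcost s p))
    \<le> (real k + 1 - 2 ^ k / real s) * (\<Sum>p<s. w p) + real k * w 0"
proof -
  let ?K = "real k + 1 - 2 ^ k / real s"
  have "s > 0" using s by (cases s) auto
  have dist: "(\<Sum>p<s. w p * (f p - K)) = (\<Sum>p<s. w p * f p) - K * (\<Sum>p<s. w p)"
    for f :: "nat \<Rightarrow> real" and K
    by (simp add: sum_distrib_left right_diff_distrib sum_subtractf mult.commute)
  have "(\<Sum>p<s. w p * (real (bcost s p) - ?K)) \<le> real k * w 0"
  proof (rule antitone_weighted_sum_le)
    fix q assume "q \<le> s"
    from sum_bcost_prefix_le[OF s this] show "(\<Sum>p<q. real (bcost s p) - ?K) \<le> real k"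
      by (simp add: sum_subtractf right_diff_distrib distrib_left)
  qed (use assms \<open>s > 0\<close> in auto)
  moreover have "(\<Sum>p<s. w p * (real (bcost s p) - ?K))
      = (\<Sum>p<s. w p * real (bcost s p)) - ?K * (\<Sum>p<s. w p)"
    by (rule dist)
  ultimately show ?thesis by linarith
qed

lemma strict_sorted_eq_sorted_list_of_set:
  "sorted_wrt (<) xs \<Longrightarrow> set xs = A \<Longrightarrow> xs = sorted_list_of_set A"
  by (metis sorted_list_of_set.idem_if_sorted_distinct strict_sorted_iff)

text \<open>Result and cost are described by the set of elements and a rank alone, so the later
  counting arguments never refer to lists or to the course of the binary search.\<close>

lemma binsert_correct:
  assumes "sorted_wrt (<) ys" "x \<notin> set ys"
  shows "fst (binsert x ys) = sorted_list_of_set (insert x (set ys))"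
    and "snd (binsert x ys) = bcost (Suc (length ys)) (card {z \<in> set ys. z < x})"
proof -
  have "sorted_wrt (<) (fst (binsert x ys)) \<and> set (fst (binsert x ys)) = insert x (set ys) \<and>
     snd (binsert x ys) = bcost (Suc (length ys)) (card {z \<in> set ys. z < x})"
    using assms
  proof (induction ys rule: length_induct)
    case (1 ys)
    show ?case
    proof (cases "ys = []")
      case True
      then show ?thesis by (simp add: binsert.simps bcost.simps)
    next
      case False
      define j where "j = length ys div 2"
      have j: "j < length ys" using False by (simp add: j_def)
      have ys: "ys = take j ys @ ys ! j # drop (Suc j) ys"
        using j by (simp add: id_take_nth_drop)
      obtain L y R where L: "L = take j ys" and y: "y = ys ! j" and R: "R = drop (Suc j) ys"
        by blast
      have eq: "ys = L @ y # R" using ys L y R by simp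
      have sety: "set ys = set L \<union> insert y (set R)" by (simp add: eq)
      have len: "length L = j" "length R = length ys - Suc j" using j L R by auto
      have so: "sorted_wrt (<) (L @ y # R)" using 1 eq by simp
      then have so': "sorted_wrt (<) L" "sorted_wrt (<) R"
        "\<forall>z\<in>set L. z < y" "\<forall>z\<in>set R. y < z" "\<forall>u\<in>set L. \<forall>v\<in>set R. u < v"
        by (auto simp: sorted_wrt_append)
      have nin: "x \<notin> set L" "x \<noteq> y" "x \<notin> set R" using 1 eq by auto
      have IH: "sorted_wrt (<) (fst (binsert x zs)) \<and> set (fst (binsert x zs)) = insert x (set zs) \<and>
          snd (binsert x zs) = bcost (Suc (length zs)) (card {z \<in> set zs. z < x})"
        if "zs = L \<or> zs = R" for zs
      proof -
        have "length zs < length ys" "sorted_wrt (<) zs" "x \<notin> set zs"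
          using that so'(1,2) nin j len by auto
        then show ?thesis using 1(1) by blast
      qed
      \<comment> \<open>A list of \<open>n\<close> elements has \<open>n + 1\<close> gaps. The pivot
        at position \<open>j\<close> leaves \<open>j + 1\<close> of them on its left and
        \<open>n - j\<close> on its right, which are the two halves in \<open>bcost\<close>.\<close>
      have g1: "(Suc (length ys) + 1) div 2 = Suc j" "Suc (length ys) div 2 = length ys - j"
        by (auto simp: j_def)
      show ?thesis
      proof (cases "x < y")
        case True
        have b: "binsert x ys = (fst (binsert x L) @ y # R, Suc (snd (binsert x L)))"
          using False True j
          by (subst binsert.simps)
            (simp add: Let_def j_def[symmetric] L y R Cons_nth_drop_Suc split: prod.split)
        have e: "{z \<in> set ys. z < x} = {z \<in> set L. z < x}"
          using so' True eq by auto
        have c: "card {z \<in> set L. z < x} < Suc j"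
          using card_mono[of "set L" "{z \<in> set L. z < x}"] card_length[of L] len by auto
        have "bcost (Suc (length ys)) (card {z \<in> set ys. z < x}) = Suc (bcost (Suc j) (card {z \<in> set L. z < x}))"
          unfolding e using False c by (subst bcost.simps) (simp only: g1, simp)
        moreover have "sorted_wrt (<) (fst (binsert x L) @ y # R)"
          using IH[of L] so' True by (auto simp: sorted_wrt_append)
        ultimately show ?thesis
          using IH[of L] sety unfolding b fst_conv snd_conv len(1) by (simp add: insert_commute)
      next
        case False
        then have yx: "y < x" using nin by auto
        have b: "binsert x ys = (L @ y # fst (binsert x R), Suc (snd (binsert x R)))"
          using False \<open>ys \<noteq> []\<close> j
          by (subst binsert.simps)
            (simp add: Let_def j_def[symmetric] L y R take_Suc_conv_app_nth split: prod.split)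
        have e: "{z \<in> set ys. z < x} = insert y (set L) \<union> {z \<in> set R. z < x}"
          using so' yx eq by auto
        have "distinct ys" using 1 by (metis strict_sorted_iff)
        then have "card (insert y (set L) \<union> {z \<in> set R. z < x}) = Suc j + card {z \<in> set R. z < x}"
          using so' len distinct_card[of L] unfolding eq
          by (subst card_Un_disjoint) auto
        then have "bcost (Suc (length ys)) (card {z \<in> set ys. z < x}) = Suc (bcost (Suc (length R)) (card {z \<in> set R. z < x}))"
          unfolding e using \<open>ys \<noteq> []\<close> j
          by (subst bcost.simps) (simp only: g1, simp add: len Suc_diff_Suc)
        moreover have "sorted_wrt (<) (L @ y # fst (binsert x R))"
          using IH[of R] so' yx by (auto simp: sorted_wrt_append)
        ultimately show ?thesis
          using IH[of R] sety unfolding b fst_conv snd_conv by (simp add: insert_commute)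
      qed
    qed
  qed
  then show "fst (binsert x ys) = sorted_list_of_set (insert x (set ys))"
    and "snd (binsert x ys) = bcost (Suc (length ys)) (card {z \<in> set ys. z < x})"
    using strict_sorted_eq_sorted_list_of_set by blast+
qed

subsection \<open>The insertion phase\<close>

definition chain_set :: "'a::linorder list \<Rightarrow> 'a list \<Rightarrow> nat set \<Rightarrow> 'a set" where
  "chain_set as B P = set as \<union> (\<lambda>l. B ! (l - 1)) ` P"

text \<open>Indices start at 1, as in \<open>ins_order\<close>; \<open>P\<close> is the set of indices already inserted, and
  \<open>i > length as\<close> only occurs for the unpaired element.\<close>
definition ins_range :: "'a::linorder list \<Rightarrow> 'a list \<Rightarrow> nat set \<Rightarrow> nat \<Rightarrow> 'a set" where
  "ins_range as B P i = {z \<in> chain_set as B P. i \<le> length as \<longrightarrow> z < as ! (i - 1)}"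

definition ins_rank :: "'a::linorder list \<Rightarrow> 'a list \<Rightarrow> nat set \<Rightarrow> nat \<Rightarrow> nat" where
  "ins_rank as B P i = card {z \<in> ins_range as B P i. z < B ! (i - 1)}"

definition ins_cost :: "'a::linorder list \<Rightarrow> 'a list \<Rightarrow> nat set \<Rightarrow> nat \<Rightarrow> nat" where
  "ins_cost as B P i = bcost (Suc (card (ins_range as B P i))) (ins_rank as B P i)"

text \<open>A named copy of the local function \<open>step\<close> of
  \<open>merge_insertion\<close>, with \<open>length as\<close> in place of
  \<open>m\<close>.\<close>

definition ins_step :: "'a::linorder list \<Rightarrow> 'a list \<Rightarrow> 'a list \<times> nat \<Rightarrow> nat \<Rightarrow> 'a list \<times> nat" where
  "ins_step as B = (\<lambda>(ch, c) i.
     let rng = (if i \<le> length as then takeWhile (\<lambda>z. z \<noteq> as ! (i - 1)) ch else ch)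
     in case binsert (B ! (i - 1)) rng of (r, c') \<Rightarrow> (r @ drop (length rng) ch, c + c'))"

text \<open>The invariant on which the insertion phase rests. \<open>B\<close> may be longer than
  \<open>as\<close> because of the unpaired element.\<close>

definition config :: "'a::linorder list \<Rightarrow> 'a list \<Rightarrow> bool" where
  "config as B \<longleftrightarrow> sorted_wrt (<) as \<and> distinct B \<and> set as \<inter> set B = {} \<and>
     (\<forall>i<length as. B ! i < as ! i) \<and> length as \<le> length B"

lemma finite_chain_set [simp]: "finite P \<Longrightarrow> finite (chain_set as B P)"
  by (simp add: chain_set_def)

lemma finite_ins_range [simp]: "finite P \<Longrightarrow> finite (ins_range as B P i)"
  by (simp add: ins_range_def)

lemma sorted_list_of_set_split:
  fixes X :: "'a::linorder set"
  assumes "finite X"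
  shows "sorted_list_of_set X =
    sorted_list_of_set {z \<in> X. z < a} @ sorted_list_of_set {z \<in> X. a \<le> z}"
  using assms
  by (intro strict_sorted_eq_sorted_list_of_set[symmetric])
    (auto simp: sorted_wrt_append intro: order.strict_trans2)

lemma takeWhile_sorted_list_of_set:
  fixes X :: "'a::linorder set"
  assumes "finite X" "a \<in> X"
  shows "takeWhile (\<lambda>z. z \<noteq> a) (sorted_list_of_set X) = sorted_list_of_set {z \<in> X. z < a}"
proof -
  have "sorted_list_of_set {z \<in> X. a \<le> z} = a # sorted_list_of_set {z \<in> X. a < z}"
    using assms by (intro strict_sorted_eq_sorted_list_of_set[symmetric]) auto
  then show ?thesis
    using assms by (subst sorted_list_of_set_split[of X a]) (auto simp: takeWhile_append)
qed

lemma B_notin_chain_set: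
  assumes "config as B" "i \<in> {1..length B}" "P \<subseteq> {1..length B}" "i \<notin> P"
  shows "B ! (i - 1) \<notin> chain_set as B P"
proof
  assume "B ! (i - 1) \<in> chain_set as B P"
  moreover have "B ! (i - 1) \<in> set B" using assms by auto
  ultimately obtain l where l: "l \<in> P" "B ! (i - 1) = B ! (l - 1)"
    using assms by (auto simp: chain_set_def config_def)
  moreover have "l \<in> {1..length B}" using l assms by blast
  ultimately have "i - 1 = l - 1"
    using assms by (subst (asm) nth_eq_iff_index_eq) (auto simp: config_def)
  with l assms \<open>l \<in> {1..length B}\<close> show False by (auto simp: eq_diff_iff)
qed

text \<open>Since \<open>b_i < a_i\<close>, inserting into the part of the chain below
  \<open>a_i\<close> keeps the whole chain sorted. The chain is thus determined by the set of
  inserted indices, and so is the cost of the next step.\<close>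

lemma ins_step_correct:
  assumes cfg: "config as B" and i: "i \<in> {1..length B}" and P: "P \<subseteq> {1..length B}" "i \<notin> P"
  shows "ins_step as B (sorted_list_of_set (chain_set as B P), c) i =
    (sorted_list_of_set (chain_set as B (insert i P)), c + ins_cost as B P i)"
proof -
  define X where "X = chain_set as B P"
  define b where "b = B ! (i - 1)"
  define R where "R = ins_range as B P i"
  have fP: "finite P" using P finite_subset by blast
  then have fX: "finite X" by (simp add: X_def)
  have RX: "R \<subseteq> X" by (auto simp: R_def X_def ins_range_def)
  then have fR: "finite R" using fX finite_subset by blast
  have bX: "b \<notin> X" unfolding b_def X_def using B_notin_chain_set[OF cfg i P] .
  define rng where "rng = (if i \<le> length as then takeWhile (\<lambda>z. z \<noteq> as ! (i - 1))
    (sorted_list_of_set X) else sorted_list_of_set X)"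
  have rng: "rng = sorted_list_of_set R"
  proof (cases "i \<le> length as")
    case True
    then have "as ! (i - 1) \<in> X" using i by (auto simp: X_def chain_set_def)
    then show ?thesis
      using True fX takeWhile_sorted_list_of_set[of X]
      by (simp add: rng_def R_def ins_range_def X_def)
  next
    case False
    then show ?thesis by (simp add: rng_def R_def ins_range_def X_def)
  qed
  have srng: "sorted_wrt (<) rng" "set rng = R" "length rng = card R"
    using fR by (auto simp: rng)
  have cost: "snd (binsert b rng) = ins_cost as B P i"
    using binsert_correct(2)[of rng b] srng RX bX
    by (auto simp: ins_cost_def ins_rank_def R_def b_def)
  have fs: "fst (binsert b rng) = sorted_list_of_set (insert b R)"
    using binsert_correct(1)[of rng b] srng RX bX by auto
  have ch: "fst (binsert b rng) @ drop (length rng) (sorted_list_of_set X) =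
      sorted_list_of_set (insert b X)"
  proof (cases "i \<le> length as")
    case True
    define a where "a = as ! (i - 1)"
    have ba: "b < a" using cfg True i by (auto simp: config_def a_def b_def)
    have R: "R = {z \<in> X. z < a}" using True by (simp add: R_def ins_range_def X_def a_def)
    have "drop (length rng) (sorted_list_of_set X) = sorted_list_of_set {z \<in> X. a \<le> z}"
      by (subst sorted_list_of_set_split[OF fX, of a]) (use fX in \<open>simp add: srng R\<close>)
    moreover have "sorted_list_of_set (insert b X) =
        sorted_list_of_set {z \<in> insert b X. z < a} @ sorted_list_of_set {z \<in> insert b X. a \<le> z}"
      using fX by (intro sorted_list_of_set_split) auto
    moreover have "{z \<in> insert b X. z < a} = insert b R" "{z \<in> insert b X. a \<le> z} = {z \<in> X. a \<le> z}"
      using ba R by auto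
    ultimately show ?thesis by (simp add: fs)
  next
    case False
    then have "R = X" by (simp add: R_def ins_range_def X_def)
    then show ?thesis using fX by (simp add: fs srng)
  qed
  have "ins_step as B (sorted_list_of_set X, c) i =
      (fst (binsert b rng) @ drop (length rng) (sorted_list_of_set X), c + snd (binsert b rng))"
    by (simp add: ins_step_def Let_def rng_def b_def split: prod.split)
  also have "\<dots> = (sorted_list_of_set (insert b X), c + ins_cost as B P i)"
    by (simp add: ch cost)
  finally show ?thesis by (simp add: X_def chain_set_def b_def)
qed

lemma foldl_ins_step:
  assumes cfg: "config as B" and "as \<noteq> []" and "set ord \<subseteq> {2..length B}" "distinct ord"
  shows "foldl (ins_step as B) (hd B # as, 0) ord =
    (sorted_list_of_set (chain_set as B (insert 1 (set ord))),
     \<Sum>q<length ord. ins_cost as B (insert 1 (set (take q ord))) (ord ! q))"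
  using assms(3,4)
proof (induction ord rule: rev_induct)
  case Nil
  have B: "B \<noteq> []" and b0: "B ! 0 < as ! 0" using cfg \<open>as \<noteq> []\<close> by (auto simp: config_def)
  have "sorted_wrt (<) as" using cfg by (simp add: config_def)
  then have "sorted_wrt (<) (hd B # as)"
    using b0 B \<open>as \<noteq> []\<close> by (cases as) (auto simp: hd_conv_nth)
  moreover have "set (hd B # as) = chain_set as B {1}"
    using B by (simp add: chain_set_def hd_conv_nth)
  ultimately have "hd B # as = sorted_list_of_set (chain_set as B {1})"
    by (rule strict_sorted_eq_sorted_list_of_set)
  then show ?case by simp
next
  case (snoc i ord)
  have "ins_step as B (sorted_list_of_set (chain_set as B (insert 1 (set ord))), c) i =
    (sorted_list_of_set (chain_set as B (insert i (insert 1 (set ord)))),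
      c + ins_cost as B (insert 1 (set ord)) i)" for c
    using snoc.prems by (intro ins_step_correct cfg) auto
  moreover have "(\<Sum>q<length ord. ins_cost as B (insert 1 (set (take q (ord @ [i])))) ((ord @ [i]) ! q)) =
      (\<Sum>q<length ord. ins_cost as B (insert 1 (set (take q ord))) (ord ! q))"
    by (intro sum.cong) (auto simp: nth_append)
  ultimately show ?case
    using snoc by (simp add: insert_commute)
qed

section \<open>Group boundaries and the insertion order\<close>

lemma two_power_mod_3: "(2::nat) ^ Suc k mod 3 = (if even k then 2 else 1)"
proof (induction k)
  case (Suc k)
  have "(2::nat) ^ Suc (Suc k) mod 3 = (2 * (2 ^ Suc k mod 3)) mod 3"
    by (simp add: mod_mult_right_eq)
  then show ?case using Suc by simp
qed simp

lemma three_tJ: "3 * tJ k = (if even k then 2 ^ Suc k + 1 else 2 ^ Suc k - 1)"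
proof -
  obtain q r where qr: "(2::nat) ^ Suc k = 3 * q + r" "r = (if even k then 2 else 1)"
    using two_power_mod_3[of k] by (metis mult_div_mod_eq)
  then show ?thesis by (auto simp: tJ_def simp del: power_Suc)
qed

text \<open>This identity is the reason for the choice of \<open>tJ\<close>: it makes a complete
  group fill its search range up to exactly a power of two.\<close>

lemma tJ_Suc: "tJ (Suc k) + tJ k = 2 ^ Suc k"
proof -
  have "(1::nat) \<le> 2 ^ Suc k" by simp
  then have "3 * (tJ (Suc k) + tJ k) = 3 * 2 ^ Suc k"
    unfolding distrib_left three_tJ by (cases "even k") auto
  then show ?thesis by simp
qed

lemma tJ_Suc_double: "tJ (Suc k) = (if even k then 2 * tJ k - 1 else 2 * tJ k + 1)"
proof -
  have "(1::nat) \<le> 2 ^ k" by simp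
  then have "3 * tJ (Suc k) = 3 * (if even k then 2 * tJ k - 1 else 2 * tJ k + 1)"
    using three_tJ[of k] three_tJ[of "Suc k"] by (cases "even k"; simp; linarith)
  then show ?thesis by simp
qed

lemma tJ_0 [simp]: "tJ 0 = 1" and tJ_1 [simp]: "tJ (Suc 0) = 1"
  by (auto simp: tJ_def)

lemma tJ_pos: "tJ k \<ge> 1"
  by (induction k) (auto simp: tJ_Suc_double)

lemma mono_tJ: "mono tJ"
proof -
  have "tJ n \<le> tJ (Suc n)" for n using tJ_pos[of n] by (auto simp: tJ_Suc_double)
  then show ?thesis by (simp add: mono_iff_le_Suc)
qed

lemma tJ_ge: "tJ k \<ge> k"
proof (induction k)
  case (Suc k)
  show ?case
  proof (cases "k \<le> 1")
    case True
    then show ?thesis by (auto simp: le_Suc_eq tJ_Suc_double)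
  next
    case False
    have "k + 1 \<le> 2 * k - 1" using False by simp
    also have "\<dots> \<le> 2 * tJ k - 1" using Suc by simp
    also have "\<dots> \<le> tJ (Suc k)" unfolding tJ_Suc_double by (cases "even k") auto
    finally show ?thesis by simp
  qed
qed simp

text \<open>The number of the group containing \<open>i\<close>, as the adjoint of
  \<open>tJ\<close>. Since \<open>tJ 0 = tJ 1 = 1\<close>, group 1 is empty,
  \<open>batch 1 = 0\<close>, and indices from 2 on lie in groups from 2 on.\<close>

definition batch :: "nat \<Rightarrow> nat" where
  "batch i = (LEAST k. i \<le> tJ k)"

lemma batch_le_iff: "batch i \<le> k \<longleftrightarrow> i \<le> tJ k"
proof
  have "i \<le> tJ (batch i)" unfolding batch_def by (rule LeastI[of _ i]) (rule tJ_ge)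
  then show "i \<le> tJ k" if "batch i \<le> k" using monoD[OF mono_tJ that] by simp
qed (simp add: batch_def Least_le)

lemma batch_less_iff: "k < batch i \<longleftrightarrow> tJ k < i"
  using batch_le_iff[of i k] by linarith

lemma batch_eqI: "tJ (k - 1) < i \<Longrightarrow> i \<le> tJ k \<Longrightarrow> batch i = k"
  using batch_le_iff[of i k] batch_less_iff[of "k - 1" i] by linarith

lemma batch_ge_2: "i \<ge> 2 \<Longrightarrow> batch i \<ge> 2"
  using batch_less_iff[of 1 i] by simp

text \<open>The indices present in the chain when \<open>b_i\<close> is inserted, for
  \<open>i\<close> between 2 and \<open>N\<close>: all earlier groups, and the larger indices of its
  own group. Index 1 is among them because \<open>b_1\<close> starts in the chain; the minimum
  accounts for a truncated last group.\<close>

definition prior :: "nat \<Rightarrow> nat \<Rightarrow> nat set" where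
  "prior N i = {1..tJ (batch i - 1)} \<union> {i<..min (tJ (batch i)) N}"

lemma set_ins_order_prefix:
  "K \<ge> 1 \<Longrightarrow> set (concat (map (\<lambda>k. rev [tJ (k - 1) + 1 ..< Suc (min (tJ k) N)]) [2 ..< Suc K])) =
     {2..min (tJ K) N}"
proof (induction K rule: dec_induct)
  case (step K)
  have "tJ K \<le> tJ (Suc K)" "tJ K \<ge> 1" using mono_tJ tJ_pos by (auto simp: mono_def)
  moreover have "[2 ..< Suc (Suc K)] = [2 ..< Suc K] @ [Suc K]" using step.hyps by simp
  ultimately show ?case using step.IH
    by (simp only: map_append concat_append set_append list.map concat.simps
        append_Nil2 diff_Suc_1 set_rev set_upt) (intro set_eqI, simp, linarith)
qed simp

lemma sorted_ins_order_prefix: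
  "K \<ge> 1 \<Longrightarrow> sorted_wrt (\<lambda>l i. batch l < batch i \<or> batch l = batch i \<and> i < l)
     (concat (map (\<lambda>k. rev [tJ (k - 1) + 1 ..< Suc (min (tJ k) N)]) [2 ..< Suc K]))"
proof (induction K rule: dec_induct)
  case (step K)
  have last: "batch i = Suc K" if "i \<in> set [tJ K + 1 ..< Suc (min (tJ (Suc K)) N)]" for i
    using that by (intro batch_eqI) auto
  have "sorted_wrt (\<lambda>l i. batch l < batch i \<or> batch l = batch i \<and> i < l)
      (rev [tJ K + 1 ..< Suc (min (tJ (Suc K)) N)])"
    unfolding sorted_wrt_rev
    by (rule sorted_wrt_mono_rel[OF _ sorted_wrt_upt]) (use last in auto)
  moreover have "batch l \<le> K" if "l \<in> {2..min (tJ K) N}" for l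
    using that by (simp add: batch_le_iff)
  moreover note step.IH set_ins_order_prefix[OF step.hyps(1), of N] last
  moreover have "[2 ..< Suc (Suc K)] = [2 ..< Suc K] @ [Suc K]" using step.hyps by simp
  ultimately show ?case
    by (simp only: map_append concat_append sorted_wrt_append list.map concat.simps
        append_Nil2 diff_Suc_1 set_rev)
      (metis le_imp_less_Suc)
qed simp

lemma ins_order_facts:
  shows set_ins_order: "set (ins_order N) = {2..N}"
    and sorted_ins_order: "sorted_wrt (\<lambda>l i. batch l < batch i \<or> batch l = batch i \<and> i < l) (ins_order N)"
    and distinct_ins_order: "distinct (ins_order N)"
proof -
  have eq: "[2 ..< N + 2] = [2 ..< Suc (N + 1)]" by simp
  show "set (ins_order N) = {2..N}"
    using set_ins_order_prefix[of "N + 1" N] tJ_ge[of "N + 1"] unfolding ins_order_def eq by simp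
  show so: "sorted_wrt (\<lambda>l i. batch l < batch i \<or> batch l = batch i \<and> i < l) (ins_order N)"
    using sorted_ins_order_prefix[of "N + 1" N] unfolding ins_order_def eq by simp
  have "ins_order N ! p \<noteq> ins_order N ! q" if "p < q" "q < length (ins_order N)" for p q
    using sorted_wrt_nth_less[OF so that] by auto
  then show "distinct (ins_order N)"
    unfolding distinct_conv_nth by (metis nat_neq_iff)
qed

text \<open>The order is sorted by a strict relation, group first and then descending index, so the
  entries before \<open>i\<close> are exactly the indices related to \<open>i\<close>.\<close>

lemma take_ins_order:
  assumes "q < length (ins_order N)"
  shows "insert 1 (set (take q (ins_order N))) = prior N (ins_order N ! q)"
proof -
  define r where "r = (\<lambda>l i. batch l < batch i \<or> batch l = batch i \<and> i < l)"
  define i where "i = ins_order N ! q"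
  have split: "ins_order N = take q (ins_order N) @ i # drop (Suc q) (ins_order N)"
    unfolding i_def using assms by (rule id_take_nth_drop)
  have so: "sorted_wrt r (take q (ins_order N) @ i # drop (Suc q) (ins_order N))"
    using sorted_ins_order[of N] unfolding split[symmetric] r_def .
  have iN: "i \<in> {2..N}" unfolding i_def set_ins_order[symmetric] using assms by simp
  have un: "set (take q (ins_order N)) \<union> insert i (set (drop (Suc q) (ins_order N))) = {2..N}"
    unfolding set_ins_order[symmetric] by (subst (3) split) simp
  have "set (take q (ins_order N)) = {l \<in> {2..N}. r l i}"
  proof (intro equalityI subsetI)
    fix l assume "l \<in> {l \<in> {2..N}. r l i}"
    then have l: "l \<in> {2..N}" "r l i" by auto
    then have "l \<noteq> i" "\<not> r i l" by (auto simp: r_def)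
    moreover have "r i l" if "l \<in> set (drop (Suc q) (ins_order N))"
      using so that by (simp add: sorted_wrt_append)
    ultimately show "l \<in> set (take q (ins_order N))" using un l(1) by blast
  qed (use so un in \<open>auto simp: sorted_wrt_append\<close>)
  also have "insert 1 \<dots> = prior N i"
  proof -
    have "batch i \<ge> 2" using iN batch_ge_2 by simp
    then have lt: "batch l < batch i \<longleftrightarrow> l \<le> tJ (batch i - 1)" for l
      using batch_le_iff[of l "batch i - 1"] by linarith
    have eq: "batch l = batch i \<longleftrightarrow> tJ (batch i - 1) < l \<and> l \<le> tJ (batch i)" for l
      using lt[of l] batch_le_iff[of l "batch i"] by linarith
    have ii: "tJ (batch i - 1) < i" "i \<le> tJ (batch i)" using eq[of i] by auto
    have "tJ (batch i - 1) \<ge> 1" by (rule tJ_pos)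
    then show ?thesis
      using iN ii by (auto simp: prior_def r_def lt eq)
  qed
  finally show ?thesis by (simp add: i_def)
qed

subsection \<open>Pairs and their sorted configuration\<close>

definition pairs :: "'a::linorder list \<Rightarrow> ('a \<times> 'a) list" where
  "pairs xs = map (\<lambda>i. (max (xs ! (2 * i)) (xs ! (2 * i + 1)),
                         min (xs ! (2 * i)) (xs ! (2 * i + 1)))) [0 ..< length xs div 2]"

text \<open>Defined by \<open>sort\<close> instead of the recursive call, so that configurations can
  be studied before the recursion is known to sort.\<close>

definition upper :: "'a::linorder list \<Rightarrow> 'a list" where
  "upper xs = sort (map fst (pairs xs))"

definition lower :: "'a::linorder list \<Rightarrow> 'a list" where
  "lower xs = map (\<lambda>a. the (map_of (pairs xs) a)) (upper xs) @
     (if odd (length xs) then [last xs] else [])"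

lemma length_pairs [simp]: "length (pairs xs) = length xs div 2"
  by (simp add: pairs_def)

lemma length_upper [simp]: "length (upper xs) = length xs div 2"
  by (simp add: upper_def)

lemma length_lower [simp]: "length (lower xs) = (length xs + 1) div 2"
  by (auto simp: lower_def elim: oddE evenE)

lemma nth_pairs: "i < length xs div 2 \<Longrightarrow> pairs xs ! i =
    (max (xs ! (2 * i)) (xs ! (2 * i + 1)), min (xs ! (2 * i)) (xs ! (2 * i + 1)))"
  by (simp add: pairs_def)

lemma pairs_nth_set:
  assumes "i < length xs div 2"
  shows "{fst (pairs xs ! i), snd (pairs xs ! i)} = {xs ! (2 * i), xs ! (2 * i + 1)}"
  using assms by (auto simp: nth_pairs max_def min_def)

lemma pairs_nth_elem:
  assumes "i < length xs div 2" "x \<in> {fst (pairs xs ! i), snd (pairs xs ! i)}"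
  obtains e where "e \<le> 1" "x = xs ! (2 * i + e)"
proof -
  have "x = xs ! (2 * i + 0) \<or> x = xs ! (2 * i + 1)"
    using assms pairs_nth_set[OF assms(1)] by simp
  with that[of 0] that[of 1] show ?thesis by auto
qed

lemma pairs_less:
  assumes "distinct xs" "(a, b) \<in> set (pairs xs)"
  shows "b < a"
proof -
  obtain i where i: "i < length xs div 2" "(a, b) = pairs xs ! i"
    using assms(2) by (metis in_set_conv_nth length_pairs)
  moreover have "xs ! (2 * i) \<noteq> xs ! (2 * i + 1)"
    using assms(1) i(1) by (subst nth_eq_iff_index_eq) auto
  ultimately show ?thesis by (auto simp: nth_pairs max_def min_def)
qed

lemma pairs_disjoint:
  assumes "distinct xs" "(a, b) \<in> set (pairs xs)" "(a', b') \<in> set (pairs xs)"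
    "{a, b} \<inter> {a', b'} \<noteq> {}"
  shows "a = a'" "b = b'"
proof -
  obtain i where i: "i < length xs div 2" "pairs xs ! i = (a, b)"
    using assms(2) by (metis in_set_conv_nth length_pairs)
  obtain j where j: "j < length xs div 2" "pairs xs ! j = (a', b')"
    using assms(3) by (metis in_set_conv_nth length_pairs)
  obtain x where x: "x \<in> {a, b}" "x \<in> {a', b'}" using assms(4) by blast
  obtain e where e: "e \<le> 1" "x = xs ! (2 * i + e)"
    using pairs_nth_elem[OF i(1), of x] x i(2) by auto
  obtain f where f: "f \<le> 1" "x = xs ! (2 * j + f)"
    using pairs_nth_elem[OF j(1), of x] x j(2) by auto
  have ef: "e \<le> 1" "f \<le> 1" "xs ! (2 * i + e) = xs ! (2 * j + f)" using e f by auto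
  have "2 * i + e = 2 * j + f"
    using assms(1) ef i j by (subst (asm) nth_eq_iff_index_eq) auto
  then have "i = j" using ef by presburger
  then show "a = a'" "b = b'" using i j by auto
qed

lemma distinct_fst_pairs:
  assumes "distinct xs"
  shows "distinct (map fst (pairs xs))"
proof -
  have "fst (pairs xs ! i) \<noteq> fst (pairs xs ! j)"
    if i: "i < length xs div 2" and j: "j < length xs div 2" and ij: "i \<noteq> j" for i j
  proof -
    obtain e where e: "e \<le> 1" "fst (pairs xs ! i) = xs ! (2 * i + e)"
      using pairs_nth_elem[OF i, of "fst (pairs xs ! i)"] by auto
    obtain f where f: "f \<le> 1" "fst (pairs xs ! j) = xs ! (2 * j + f)"
      using pairs_nth_elem[OF j, of "fst (pairs xs ! j)"] by auto
    have "2 * i + e \<noteq> 2 * j + f" using e f ij by presburger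
    then show ?thesis
      using assms e f i j by (simp add: nth_eq_iff_index_eq)
  qed
  then show ?thesis by (simp add: distinct_conv_nth)
qed

lemma set_upper: "set (upper xs) = fst ` set (pairs xs)"
  by (simp add: upper_def)

lemma strict_sorted_upper: "distinct xs \<Longrightarrow> sorted_wrt (<) (upper xs)"
  using distinct_fst_pairs[of xs] by (simp add: upper_def strict_sorted_iff)

lemma upper_lower_pairs:
  assumes "distinct xs" "i < length xs div 2"
  shows "(upper xs ! i, lower xs ! i) \<in> set (pairs xs)"
proof -
  have "upper xs ! i \<in> fst ` set (pairs xs)"
    using assms by (metis set_upper length_upper nth_mem)
  then obtain b where b: "(upper xs ! i, b) \<in> set (pairs xs)" by auto
  then have "map_of (pairs xs) (upper xs ! i) = Some b"
    using distinct_fst_pairs[OF assms(1)] by simp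
  then have "lower xs ! i = b" using assms by (simp add: lower_def nth_append)
  with b show ?thesis by simp
qed

lemma pairs_upper_lower:
  assumes "distinct xs" "(a, b) \<in> set (pairs xs)"
  obtains i where "i < length xs div 2" "upper xs ! i = a" "lower xs ! i = b"
proof -
  have "a \<in> set (upper xs)" using assms by (force simp: set_upper)
  then obtain i where i: "i < length xs div 2" "upper xs ! i = a"
    by (metis in_set_conv_nth length_upper)
  with upper_lower_pairs[OF assms(1) i(1)] assms have "lower xs ! i = b"
    using pairs_disjoint(2)[OF assms(1) assms(2), of a "lower xs ! i"] by auto
  with i that show ?thesis by blast
qed

lemma lower_leftover: "odd (length xs) \<Longrightarrow> lower xs ! (length xs div 2) = xs ! (length xs - 1)"
  by (cases xs rule: rev_cases) (auto simp: lower_def nth_append)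

lemma pairs_elems:
  assumes "(a, b) \<in> set (pairs xs)"
  obtains p q where "p < 2 * (length xs div 2)" "q < 2 * (length xs div 2)" "a = xs ! p" "b = xs ! q"
proof -
  obtain i where i: "i < length xs div 2" "pairs xs ! i = (a, b)"
    using assms by (metis in_set_conv_nth length_pairs)
  then have "a \<in> {xs ! (2 * i), xs ! (2 * i + 1)}" "b \<in> {xs ! (2 * i), xs ! (2 * i + 1)}"
    using pairs_nth_set[OF i(1)] by auto
  moreover have "2 * i < 2 * (length xs div 2)" "2 * i + 1 < 2 * (length xs div 2)" using i by auto
  ultimately show ?thesis using that by blast
qed

lemma last_notin_pairs:
  assumes "distinct xs" "odd (length xs)" "(a, b) \<in> set (pairs xs)"
  shows "xs ! (length xs - 1) \<noteq> a" "xs ! (length xs - 1) \<noteq> b"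
proof -
  obtain p q where pq: "p < 2 * (length xs div 2)" "q < 2 * (length xs div 2)" "a = xs ! p" "b = xs ! q"
    using assms(3) by (rule pairs_elems)
  have "length xs > 0" using assms by (cases xs) auto
  moreover have "p < length xs - 1" "q < length xs - 1" using pq assms(2) by (auto elim: oddE)
  ultimately show "xs ! (length xs - 1) \<noteq> a" "xs ! (length xs - 1) \<noteq> b"
    using assms(1) unfolding pq by (auto simp: nth_eq_iff_index_eq)
qed

lemma config_upper_lower:
  assumes "distinct xs"
  shows "config (upper xs) (lower xs)"
proof -
  let ?m = "length xs div 2"
  have pr: "(upper xs ! i, lower xs ! i) \<in> set (pairs xs)" if "i < ?m" for i
    using upper_lower_pairs[OF assms that] .
  have lt: "lower xs ! i < upper xs ! i" if "i < ?m" for i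
    using pairs_less[OF assms pr[OF that]] .
  have du: "distinct (upper xs)" using strict_sorted_upper[OF assms] by (simp add: strict_sorted_iff)
  have inj: "i = j" if "i < ?m" "j < ?m" "lower xs ! i = lower xs ! j" for i j
  proof -
    have "upper xs ! i = upper xs ! j"
      using pairs_disjoint(1)[OF assms pr[OF that(1)] pr[OF that(2)]] that by simp
    then show ?thesis using du that by (simp add: nth_eq_iff_index_eq)
  qed
  have idx: "i < ?m \<or> odd (length xs) \<and> i = ?m" if "i < length (lower xs)" for i
    using that by (auto elim!: evenE oddE)
  have last: "lower xs ! i \<noteq> lower xs ! ?m" if "i < ?m" "odd (length xs)" for i
    using last_notin_pairs(2)[OF assms that(2) pr[OF that(1)]] lower_leftover[OF that(2)] by simp
  have "distinct (lower xs)"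
    unfolding distinct_conv_nth using idx inj last by metis
  moreover have "set (upper xs) \<inter> set (lower xs) = {}"
  proof -
    have "upper xs ! i \<noteq> lower xs ! j" if "i < ?m" "j < length (lower xs)" for i j
      using idx[OF that(2)]
    proof
      assume "j < ?m"
      then show ?thesis
        using pairs_disjoint(2)[OF assms pr[OF that(1)] pr[of j]] lt[OF that(1)] by auto
    next
      assume "odd (length xs) \<and> j = ?m"
      then show ?thesis
        using last_notin_pairs(1)[OF assms _ pr[OF that(1)]] lower_leftover[of xs] by auto
    qed
    then show ?thesis by (metis disjoint_iff in_set_conv_nth length_upper)
  qed
  ultimately show ?thesis
    using strict_sorted_upper[OF assms] lt by (auto simp: config_def)
qed

lemma set_upper_lower:
  assumes "distinct xs"
  shows "set (upper xs) \<union> set (lower xs) = set xs"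
proof (rule card_subset_eq)
  let ?m = "length xs div 2"
  have pe: "a \<in> set xs \<and> b \<in> set xs" if "(a, b) \<in> set (pairs xs)" for a b
    using pairs_elems[OF that] by (metis dual_order.strict_trans1 nth_mem times_div_less_eq_dividend)
  have "lower xs ! i \<in> set xs" if "i < length (lower xs)" for i
  proof (cases "i < ?m")
    case True
    then show ?thesis using upper_lower_pairs[OF assms True] pe by blast
  next
    case False
    with that have "odd (length xs)" "i = ?m" by (auto elim!: evenE oddE)
    moreover from this have "xs \<noteq> []" by auto
    ultimately show ?thesis using lower_leftover[of xs] by auto
  qed
  then show "set (upper xs) \<union> set (lower xs) \<subseteq> set xs"
    using pe by (auto simp: set_upper in_set_conv_nth[of _ "lower xs"])
  have cfg: "config (upper xs) (lower xs)" using config_upper_lower[OF assms] .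
  then have "card (set (upper xs) \<union> set (lower xs)) = length (upper xs) + length (lower xs)"
    by (auto simp: config_def card_Un_disjoint distinct_card strict_sorted_iff)
  also have "\<dots> = length xs" by simp
  finally show "card (set (upper xs) \<union> set (lower xs)) = card (set xs)"
    using assms by (simp add: distinct_card)
qed simp

lemma image_nth_pred: "(\<lambda>l. B ! (l - 1)) ` {1..length B} = set B"
proof -
  have "(\<lambda>l. B ! (l - 1)) ` Suc ` {..<length B} = set B"
    by (auto simp: image_image set_conv_nth)
  then show ?thesis by (simp add: image_Suc_lessThan)
qed

declare merge_insertion.simps [simp del]

text \<open>Correctness of the recursive call is a hypothesis because
  \<open>fst_merge_insertion\<close> obtains correctness from this lemma by induction on the
  length.\<close>

lemma merge_insertion_step:
  assumes "distinct xs" "length xs \<ge> 2"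
    and rec: "fst (merge_insertion (map fst (pairs xs))) = upper xs"
  shows "merge_insertion xs =
    (sorted_list_of_set (set xs),
     length xs div 2 + snd (merge_insertion (map fst (pairs xs))) +
     (\<Sum>i = 2..length (lower xs). ins_cost (upper xs) (lower xs) (prior (length (lower xs)) i) i))"
proof -
  let ?N = "length (lower xs)"
  let ?ord = "ins_order ?N"
  have cfg: "config (upper xs) (lower xs)" using config_upper_lower[OF assms(1)] .
  have ne: "upper xs \<noteq> []" using assms(2) by (metis length_upper list.size(3) div_greater_zero_iff less_irrefl pos2)
  have N1: "?N \<ge> 1" using assms(2) by simp
  obtain c where mi: "merge_insertion (map fst (pairs xs)) = (upper xs, c)"
    using rec by (metis prod.collapse)
  have step: "ins_step (upper xs) (lower xs) = (\<lambda>(ch, c) i.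
     let rng = (if i \<le> length xs div 2 then takeWhile (\<lambda>z. z \<noteq> upper xs ! (i - 1)) ch else ch)
     in case binsert (lower xs ! (i - 1)) rng of (r, c') \<Rightarrow> (r @ drop (length rng) ch, c + c'))"
    by (simp add: ins_step_def)
  have "merge_insertion xs =
     (let res = foldl (ins_step (upper xs) (lower xs)) (hd (lower xs) # upper xs, 0) ?ord
      in (fst res, length xs div 2 + c + snd res))"
    using assms(2) unfolding step
    by (subst merge_insertion.simps)
      (simp only: pairs_def[symmetric] Let_def mi lower_def[symmetric] prod.case, simp)
  also have "\<dots> = (sorted_list_of_set (chain_set (upper xs) (lower xs) (insert 1 (set ?ord))),
     length xs div 2 + c + (\<Sum>q<length ?ord. ins_cost (upper xs) (lower xs) (insert 1 (set (take q ?ord))) (?ord ! q)))"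
    by (subst foldl_ins_step[OF cfg ne]) (auto simp: set_ins_order distinct_ins_order)
  also have "chain_set (upper xs) (lower xs) (insert 1 (set ?ord)) = set xs"
  proof -
    have "(\<lambda>l. lower xs ! (l - 1)) ` {1..?N} = set (lower xs)"
      by (rule image_nth_pred)
    moreover have "insert 1 {2..?N} = {1..?N}" using N1 by auto
    ultimately show ?thesis
      by (simp only: chain_set_def set_ins_order set_upper_lower[OF assms(1)])
  qed
  also have "(\<Sum>q<length ?ord. ins_cost (upper xs) (lower xs) (insert 1 (set (take q ?ord))) (?ord ! q))
     = (\<Sum>q<length ?ord. ins_cost (upper xs) (lower xs) (prior ?N (?ord ! q)) (?ord ! q))"
    by (intro sum.cong refl) (simp only: take_ins_order lessThan_iff)
  \<comment> \<open>The cost of inserting \<open>b_i\<close> now depends on \<open>i\<close> only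
    through \<open>prior\<close>, so the sum may forget the insertion order.\<close>
  also have "\<dots> = (\<Sum>i\<in>set ?ord. ins_cost (upper xs) (lower xs) (prior ?N i) i)"
    using sum.reindex_bij_betw[OF bij_betw_nth[OF distinct_ins_order refl refl]] .
  finally show ?thesis by (simp add: mi set_ins_order)
qed

lemma fst_merge_insertion:
  "distinct xs \<Longrightarrow> fst (merge_insertion xs) = sorted_list_of_set (set xs)"
proof (induction xs rule: length_induct)
  case (1 xs)
  show ?case
  proof (cases "length xs \<ge> 2")
    case True
    have "fst (merge_insertion (map fst (pairs xs))) = sorted_list_of_set (set (map fst (pairs xs)))"
      using 1 True distinct_fst_pairs[of xs] by simp
    also have "\<dots> = upper xs"
      using strict_sorted_eq_sorted_list_of_set[OF strict_sorted_upper[OF 1(2)] refl]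
      by (simp add: set_upper)
    finally show ?thesis using merge_insertion_step[OF 1(2) True] by simp
  next
    case False
    then have "xs = [] \<or> (\<exists>x. xs = [x])" by (cases xs; cases "tl xs") auto
    then show ?thesis by (auto simp: merge_insertion.simps)
  qed
qed

lemma snd_merge_insertion:
  assumes "distinct xs" "length xs \<ge> 2"
  shows "snd (merge_insertion xs) =
     length xs div 2 + snd (merge_insertion (map fst (pairs xs))) +
     (\<Sum>i = 2..length (lower xs). ins_cost (upper xs) (lower xs) (prior (length (lower xs)) i) i)"
proof -
  have "fst (merge_insertion (map fst (pairs xs))) = upper xs"
    using fst_merge_insertion[OF distinct_fst_pairs[OF assms(1)]]
      strict_sorted_eq_sorted_list_of_set[OF strict_sorted_upper[OF assms(1)] refl]
    by (simp add: set_upper)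
  from merge_insertion_step[OF assms this] show ?thesis by simp
qed

text \<open>A relabelling of values need not be monotone: the configuration is transported as soon
  as the order of the maxima and the outcome inside each pair survive. This is what permits
  transposing two values.\<close>

lemma upper_lower_map:
  assumes "distinct xs" and inj: "inj_on f (set xs)"
    and mono: "sorted_wrt (<) (map f (upper xs))"
    and less: "\<And>i. i < length xs div 2 \<Longrightarrow> f (lower xs ! i) < f (upper xs ! i)"
  shows "upper (map f xs) = map f (upper xs)" "lower (map f xs) = map f (lower xs)"
proof -
  let ?m = "length xs div 2"
  have lt: "f b < f a" if "(a, b) \<in> set (pairs xs)" for a b
    using pairs_upper_lower[OF assms(1) that] less by metis
  have prs: "pairs (map f xs) = map (map_prod f f) (pairs xs)"
  proof (rule nth_equalityI)
    fix i assume "i < length (pairs (map f xs))"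
    then have i: "i < ?m" by simp
    then have b: "2 * i < length xs" "2 * i + 1 < length xs" by auto
    obtain a b' where ab: "pairs xs ! i = (a, b')" by fastforce
    then have "(a, b') \<in> set (pairs xs)" using i by (metis length_pairs nth_mem)
    from lt[OF this] have "f b' < f a" .
    then show "pairs (map f xs) ! i = map (map_prod f f) (pairs xs) ! i"
      using i b ab by (auto simp: nth_pairs max_def min_def split: if_splits)
  qed simp
  have "set (map f (upper xs)) = set (upper (map f xs))"
    by (simp add: set_upper prs image_image)
  moreover have dm: "distinct (map f xs)" using assms by (simp add: distinct_map)
  ultimately show up: "upper (map f xs) = map f (upper xs)"
    using strict_sorted_eq_sorted_list_of_set[OF mono]
      strict_sorted_eq_sorted_list_of_set[OF strict_sorted_upper[OF dm]] by metis
  show "lower (map f xs) = map f (lower xs)"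
  proof (rule nth_equalityI)
    fix i assume "i < length (lower (map f xs))"
    then have i: "i < length (lower xs)" by simp
    show "lower (map f xs) ! i = map f (lower xs) ! i"
    proof (cases "i < ?m")
      case True
      have "(upper xs ! i, lower xs ! i) \<in> set (pairs xs)"
        using upper_lower_pairs[OF assms(1) True] .
      then have "(f (upper xs ! i), f (lower xs ! i)) \<in> set (pairs (map f xs))"
        by (force simp: prs)
      moreover have "(f (upper xs ! i), lower (map f xs) ! i) \<in> set (pairs (map f xs))"
        using upper_lower_pairs[OF dm, of i] True by (simp add: up)
      ultimately have "f (lower xs ! i) = lower (map f xs) ! i"
        using pairs_disjoint(2)[OF dm, of "f (upper xs ! i)" "f (lower xs ! i)"
            "f (upper xs ! i)" "lower (map f xs) ! i"] by simp
      then show ?thesis using i by simp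
    next
      case False
      with i have *: "odd (length xs)" "i = ?m" by (auto elim!: evenE oddE)
      then have "length xs > 0" by (cases xs) auto
      then show ?thesis
        using * i lower_leftover[of xs] lower_leftover[of "map f xs"] by simp
    qed
  qed simp
qed

subsection \<open>Exchanging values in permutations\<close>

lemma nth_pred_inj:
  "distinct B \<Longrightarrow> l \<in> {1..length B} \<Longrightarrow> i \<in> {1..length B} \<Longrightarrow> B ! (l - 1) = B ! (i - 1) \<longleftrightarrow> l = i"
  by (subst nth_eq_iff_index_eq) auto

lemma inj_on_transpose: "inj_on (transpose u v) X"
  by (rule inj_on_inverseI[of _ "transpose u v"]) simp

lemma map_transpose_permutations_of_set:
  assumes "xs \<in> permutations_of_set A" "u \<in> A" "v \<in> A"
  shows "map (transpose u v) xs \<in> permutations_of_set A"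
  using assms by (auto simp: permutations_of_set_def distinct_map transpose_image_eq)

context
  fixes xs :: "'a::linorder list" and P :: "nat set" and j :: nat
  assumes dist: "distinct xs" and j: "j \<in> {1..(length xs + 1) div 2}"
    and P: "P \<subseteq> {1..(length xs + 1) div 2}" "j \<notin> P"
begin

private abbreviation "R \<equiv> ins_range (upper xs) (lower xs) P j"
private abbreviation "b \<equiv> lower xs ! (j - 1)"

private lemma cfg: "config (upper xs) (lower xs)"
  using dist by (rule config_upper_lower)

lemma finite_index_set: "finite P"
  using P finite_subset by blast

lemma inserted_notin_range: "b \<notin> R"
  using B_notin_chain_set[OF cfg, of j P] j P by (simp add: ins_range_def)

lemma inserted_notin_upper: "b \<notin> set (upper xs)"
proof -
  have "b \<in> set (lower xs)" using j by (intro nth_mem) auto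
  then show ?thesis using cfg by (auto simp: config_def)
qed

lemma inserted_less_upper: "j \<le> length xs div 2 \<Longrightarrow> b < upper xs ! (j - 1)"
  using cfg j by (auto simp: config_def)

lemma inserted_in_set: "b \<in> set xs"
proof -
  have "b \<in> set (lower xs)" using j by (intro nth_mem) auto
  then show ?thesis using set_upper_lower[OF dist] by blast
qed

lemma range_subset_set: "R \<subseteq> set xs"
proof -
  have "(\<lambda>l. lower xs ! (l - 1)) ` P \<subseteq> (\<lambda>l. lower xs ! (l - 1)) ` {1..length (lower xs)}"
    using P by (intro image_mono) simp
  then show ?thesis
    using set_upper_lower[OF dist] unfolding image_nth_pred ins_range_def chain_set_def by auto
qed

text \<open>Values strictly between \<open>z\<close> and \<open>b\<close> can only belong to smaller
  elements not yet inserted: anything in the chain there would lie in the range, against the choice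
  of \<open>z\<close>. Hence no maximum is overtaken, all pairs keep their orientation, and the
  range merely has \<open>z\<close> replaced by \<open>b\<close>.\<close>

lemma swap_predecessor:
  assumes z: "z \<in> R" "z < b" and adj: "\<And>y. y \<in> R \<Longrightarrow> y < b \<Longrightarrow> y \<le> z"
  defines "ys \<equiv> map (transpose z b) xs"
  shows "ins_range (upper ys) (lower ys) P j = insert b (R - {z})" "lower ys ! (j - 1) = z"
proof -
  let ?f = "transpose z b" and ?m = "length xs div 2"
  \<comment> \<open>A maximum between \<open>z\<close> and \<open>b\<close> would be below
    \<open>a_j\<close> as well, hence in the range. For the unpaired element the range is the whole
    chain.\<close>
  have above: "b < u" if "u \<in> set (upper xs)" "z < u" for u
  proof (rule ccontr)
    assume "\<not> b < u"
    then have ub: "u < b" using inserted_notin_upper that by (metis linorder_neqE)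
    then have "u \<in> R"
      using that inserted_less_upper by (auto simp: ins_range_def chain_set_def)
    with adj[OF this ub] that show False by simp
  qed
  have fu: "?f u = (if u = z then b else u)" if "u \<in> set (upper xs)" for u
    using that inserted_notin_upper by (auto simp: transpose_def)
  have "sorted_wrt (<) (upper xs)" using cfg by (simp add: config_def)
  then have "sorted_wrt (\<lambda>u v. ?f u < ?f v) (upper xs)"
    by (rule sorted_wrt_mono_rel[rotated]) (use fu above z in auto)
  then have s: "sorted_wrt (<) (map ?f (upper xs))" by (simp add: sorted_wrt_map)
  have l: "?f (lower xs ! i) < ?f (upper xs ! i)" if i: "i < ?m" for i
  proof -
    have lu: "lower xs ! i < upper xs ! i" using cfg i by (simp add: config_def)
    have u: "upper xs ! i \<in> set (upper xs)" using i by simp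
    consider "lower xs ! i = z" | "lower xs ! i = b" | "lower xs ! i \<noteq> z" "lower xs ! i \<noteq> b" by blast
    then show ?thesis
    proof cases
      case 1
      then show ?thesis using above[OF u] lu fu[OF u] by auto
    next
      case 2
      then show ?thesis using fu[OF u] lu z by auto
    next
      case 3
      then show ?thesis using fu[OF u] lu z by auto
    qed
  qed
  have ul: "upper ys = map ?f (upper xs)" "lower ys = map ?f (lower xs)"
    unfolding ys_def by (rule upper_lower_map[OF dist inj_on_transpose s l], assumption)+
  have jl: "j - 1 < length (lower xs)" using j by auto
  then show "lower ys ! (j - 1) = z" by (simp add: ul)
  have "(\<lambda>l. map ?f (lower xs) ! (l - 1)) ` P = (\<lambda>l. ?f (lower xs ! (l - 1))) ` P"
  proof (rule image_cong[OF refl])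
    fix l assume "l \<in> P"
    then have "l - 1 < length (lower xs)" using P by force
    then show "map ?f (lower xs) ! (l - 1) = ?f (lower xs ! (l - 1))" by simp
  qed
  then have ch: "chain_set (upper ys) (lower ys) P = ?f ` chain_set (upper xs) (lower xs) P"
    by (simp add: chain_set_def ul image_Un image_image)
  have cond: "(j \<le> ?m \<longrightarrow> ?f y < upper ys ! (j - 1)) \<longleftrightarrow> (j \<le> ?m \<longrightarrow> y < upper xs ! (j - 1))" for y
  proof (cases "j \<le> ?m")
    case True
    have ba: "b < upper xs ! (j - 1)" using inserted_less_upper[OF True] .
    have jm: "j - 1 < ?m" using j True by auto
    then have "upper ys ! (j - 1) = ?f (upper xs ! (j - 1))" by (simp add: ul)
    also have "\<dots> = upper xs ! (j - 1)" using ba z by (auto simp: transpose_def)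
    finally show ?thesis using ba z by (auto simp: transpose_def)
  qed simp
  have "ins_range (upper ys) (lower ys) P j = ?f ` R"
    unfolding ins_range_def ch using cond by (auto simp: ul)
  also have "\<dots> = insert b (R - {z})"
    using z(1) inserted_notin_range by (auto simp: transpose_def image_def)
  finally show "ins_range (upper ys) (lower ys) P j = insert b (R - {z})" .
qed

text \<open>The maxima are untouched, and both pairs stay oriented: \<open>b_l\<close> only becomes
  smaller, while the new \<open>b_j\<close> satisfies \<open>b_l < a_l < a_j\<close> because
  \<open>l < j\<close>.\<close>

lemma swap_lower:
  assumes l: "l \<in> P" "l < j" and less: "b < lower xs ! (l - 1)"
  defines "ys \<equiv> map (transpose b (lower xs ! (l - 1))) xs"
  shows "lower ys = map (transpose b (lower xs ! (l - 1))) (lower xs)"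
proof -
  let ?c = "lower xs ! (l - 1)"
  let ?f = "transpose b ?c" and ?m = "length xs div 2"
  have l1: "l \<in> {1..(length xs + 1) div 2}" using l P by blast
  then have "?c \<in> set (lower xs)" by (intro nth_mem) auto
  then have "?c \<notin> set (upper xs)" using cfg by (auto simp: config_def)
  then have fu: "?f u = u" if "u \<in> set (upper xs)" for u
    using that inserted_notin_upper by (auto simp: transpose_def)
  then have "map ?f (upper xs) = upper xs" by (simp add: map_idI)
  then have s: "sorted_wrt (<) (map ?f (upper xs))" using cfg by (simp add: config_def)
  have lt: "?f (lower xs ! i) < ?f (upper xs ! i)" if i: "i < ?m" for i
  proof -
    have lu: "lower xs ! i < upper xs ! i" using cfg i by (simp add: config_def)
    have u: "?f (upper xs ! i) = upper xs ! i" using i by (intro fu) simp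
    have d: "distinct (lower xs)" using cfg by (simp add: config_def)
    consider "lower xs ! i = b" | "lower xs ! i = ?c" | "lower xs ! i \<noteq> b" "lower xs ! i \<noteq> ?c" by blast
    then show ?thesis
    proof cases
      case 1
      then have ij: "i = j - 1" using d i j by (subst (asm) nth_eq_iff_index_eq) auto
      then have "l - 1 < i" using l l1 by auto
      then have "upper xs ! (l - 1) < upper xs ! i"
        using cfg i by (simp add: config_def sorted_wrt_iff_nth_less)
      moreover have "?c < upper xs ! (l - 1)" using cfg i \<open>l - 1 < i\<close> by (simp add: config_def)
      ultimately show ?thesis using 1 u by auto
    next
      case 2
      then show ?thesis using u lu less by auto
    next
      case 3
      then show ?thesis using u lu by auto
    qed
  qed
  show ?thesis
    unfolding ys_def by (rule upper_lower_map(2)[OF dist inj_on_transpose s lt])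
qed

lemma lower_prior_in_range:
  assumes l: "l \<in> P" "l < j"
  shows "lower xs ! (l - 1) \<in> R"
proof -
  have l1: "l \<ge> 1" using l P by force
  have "lower xs ! (l - 1) < upper xs ! (j - 1)" if "j \<le> length xs div 2"
  proof -
    have "l - 1 < j - 1" "j - 1 < length xs div 2" using l l1 that by auto
    then have "upper xs ! (l - 1) < upper xs ! (j - 1)" "lower xs ! (l - 1) < upper xs ! (l - 1)"
      using cfg by (auto simp: config_def sorted_wrt_iff_nth_less)
    then show ?thesis by simp
  qed
  then show ?thesis using l by (auto simp: ins_range_def chain_set_def)
qed

lemma range_eq_upper:
  "{z \<in> set (upper xs). j \<le> length xs div 2 \<longrightarrow> z < upper xs ! (j - 1)} = (!) (upper xs) ` {..<j - 1}"
proof (cases "j \<le> length xs div 2")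
  case True
  have so: "sorted_wrt (<) (upper xs)" using cfg by (simp add: config_def)
  have iff: "upper xs ! i < upper xs ! (j - 1) \<longleftrightarrow> i < j - 1" if "i < length xs div 2" for i
    using that True j sorted_wrt_nth_less[OF so, of i "j - 1"] sorted_wrt_nth_less[OF so, of "j - 1" i]
    by (cases i "j - 1" rule: linorder_cases) auto
  have "{z \<in> set (upper xs). z < upper xs ! (j - 1)} =
      (!) (upper xs) ` {i. i < length xs div 2 \<and> upper xs ! i < upper xs ! (j - 1)}"
    by (auto simp: set_conv_nth)
  also have "{i. i < length xs div 2 \<and> upper xs ! i < upper xs ! (j - 1)} = {..<j - 1}"
    using iff True by auto
  finally show ?thesis using True by simp
next
  case False
  then have "j - 1 = length xs div 2" using j by auto
  then show ?thesis using False by (auto simp: set_conv_nth)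
qed

lemma card_range_le: "card R \<le> j - 1 + card P"
proof -
  have "R \<subseteq> (!) (upper xs) ` {..<j - 1} \<union> (\<lambda>l. lower xs ! (l - 1)) ` P"
    unfolding range_eq_upper[symmetric] by (auto simp: ins_range_def chain_set_def)
  then have "card R \<le> card ((!) (upper xs) ` {..<j - 1} \<union> (\<lambda>l. lower xs ! (l - 1)) ` P)"
    using finite_index_set by (intro card_mono) auto
  also have "\<dots> \<le> card {..<j - 1} + card P"
    using finite_index_set by (intro order_trans[OF card_Un_le] add_mono card_image_le) auto
  finally show ?thesis by simp
qed

text \<open>The elements \<open>a_1, ..., a_{j-1}\<close> and \<open>b_1, ..., b_t\<close> belong to
  the range for every permutation. This keeps the random number of gaps large enough for the mean
  cost formula to apply.\<close>

lemma card_range_ge: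
  assumes "{1..t} \<subseteq> P" "t < j"
  shows "j - 1 + t \<le> card R"
proof -
  let ?U = "(!) (upper xs) ` {..<j - 1}" and ?L = "(\<lambda>l. lower xs ! (l - 1)) ` {1..t}"
  have N: "{1..t} \<subseteq> {1..length (lower xs)}" using assms j by auto
  have "j - 1 \<le> length (upper xs)" using j by auto
  then have "card ?U = j - 1"
    using cfg by (subst card_image) (auto simp: config_def inj_on_def nth_eq_iff_index_eq strict_sorted_iff)
  moreover have "card ?L = t"
  proof -
    have "inj_on (\<lambda>l. lower xs ! (l - 1)) {1..t}"
    proof (rule inj_onI)
      fix x y assume "x \<in> {1..t}" "y \<in> {1..t}" "lower xs ! (x - 1) = lower xs ! (y - 1)"
      moreover have "distinct (lower xs)" using cfg by (simp add: config_def)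
      ultimately show "x = y" using N nth_pred_inj[of "lower xs" x y] by blast
    qed
    then show ?thesis by (simp add: card_image)
  qed
  moreover have "?U \<inter> ?L = {}"
  proof -
    have "?L \<subseteq> set (lower xs)" unfolding image_nth_pred[symmetric] using N by (intro image_mono)
    moreover have "?U \<subseteq> set (upper xs)" using \<open>j - 1 \<le> _\<close> by auto
    ultimately show ?thesis using cfg by (auto simp: config_def)
  qed
  ultimately have "j - 1 + t = card (?U \<union> ?L)" by (subst card_Un_disjoint) auto
  also have "\<dots> \<le> card R"
  proof (rule card_mono)
    show "finite R" using finite_index_set by simp
    have "?U \<subseteq> R" unfolding range_eq_upper[symmetric] by (auto simp: ins_range_def chain_set_def)
    moreover have "?L \<subseteq> R" using assms by (intro image_subsetI lower_prior_in_range) auto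
    ultimately show "?U \<union> ?L \<subseteq> R" by simp
  qed
  finally show ?thesis .
qed

end

section \<open>Distribution of the gap that an inserted element falls into\<close>

context
  fixes A :: "'a::linorder set" and P :: "nat set" and j :: nat
  assumes A: "finite A" and j: "j \<in> {1..(card A + 1) div 2}"
    and P: "P \<subseteq> {1..(card A + 1) div 2}" "j \<notin> P"
begin

private abbreviation "rg xs \<equiv> ins_range (upper xs) (lower xs) P j"
private abbreviation "ins xs \<equiv> lower xs ! (j - 1)"
private abbreviation "rank xs \<equiv> ins_rank (upper xs) (lower xs) P j"

private lemma perm:
  assumes "xs \<in> permutations_of_set A"
  shows "distinct xs" "set xs = A" "j \<in> {1..(length xs + 1) div 2}" "P \<subseteq> {1..(length xs + 1) div 2}"
proof -
  show "distinct xs" "set xs = A" using assms by (auto simp: permutations_of_set_def)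
  then have "length xs = card A" using distinct_card by fastforce
  then show "j \<in> {1..(length xs + 1) div 2}" "P \<subseteq> {1..(length xs + 1) div 2}" using j P by simp_all
qed

text \<open>Exchanging the values of the inserted element and of its predecessor in the range moves it
  one gap to the left, and the original permutation can be recovered.\<close>
lemma card_rank_Suc_le:
  "card {xs \<in> permutations_of_set A. card (rg xs) = s \<and> rank xs = Suc g}
    \<le> card {xs \<in> permutations_of_set A. card (rg xs) = s \<and> rank xs = g}"
proof (rule card_inj_on_le)
  define \<phi> where "\<phi> xs = map (transpose (Max {y \<in> rg xs. y < ins xs}) (ins xs)) xs" for xs :: "'a list"
  define \<psi> where "\<psi> ys = map (transpose (ins ys) (Min {y \<in> rg ys. ins ys < y})) ys" for ys :: "'a list"
  have main: "\<phi> xs \<in> permutations_of_set A \<and> card (rg (\<phi> xs)) = s \<and> rank (\<phi> xs) = g \<and> \<psi> (\<phi> xs) = xs"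
    if "xs \<in> permutations_of_set A" "card (rg xs) = s" "rank xs = Suc g" for xs
  proof -
    note pm = perm[OF that(1)] P(2)
    have fR: "finite (rg xs)" using finite_index_set[OF pm(1,3-5)] by simp
    define z where "z = Max {y \<in> rg xs. y < ins xs}"
    have ne: "{y \<in> rg xs. y < ins xs} \<noteq> {}" using that(3) unfolding ins_rank_def by (metis card.empty Zero_not_Suc)
    then have "z \<in> {y \<in> rg xs. y < ins xs}" unfolding z_def using fR by (intro Max_in) auto
    then have z: "z \<in> rg xs" "z < ins xs" by auto
    have adj: "y \<le> z" if "y \<in> rg xs" "y < ins xs" for y
      unfolding z_def using fR that by (intro Max_ge) auto
    note sw = swap_predecessor[OF pm(1,3-5) z adj]
    have \<phi>: "\<phi> xs = map (transpose z (ins xs)) xs" by (simp add: \<phi>_def z_def)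
    have bR: "ins xs \<notin> rg xs" using inserted_notin_range[OF pm(1,3-5)] .
    have R': "rg (\<phi> xs) = insert (ins xs) (rg xs - {z})" and b': "ins (\<phi> xs) = z"
      using sw by (auto simp: \<phi>)
    have "\<phi> xs \<in> permutations_of_set A"
      unfolding \<phi> using that(1) z range_subset_set[OF pm(1,3-5)] inserted_in_set[OF pm(1,3-5)] pm(2)
      by (intro map_transpose_permutations_of_set) auto
    moreover have "card (rg (\<phi> xs)) = s"
      unfolding R' using bR z fR that(2) by (simp add: card_Suc_Diff1 del: card_Diff_insert card_Diff_singleton)
    moreover have "rank (\<phi> xs) = g"
    proof -
      have "{y \<in> rg xs. y < ins xs} = insert z {y \<in> rg xs. y < z}"
        using z adj by (auto simp: le_less dest: less_trans)
      then have "Suc g = Suc (card {y \<in> rg xs. y < z})"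
        using that(3) fR unfolding ins_rank_def by simp
      moreover have "{y \<in> insert (ins xs) (rg xs - {z}). y < z} = {y \<in> rg xs. y < z}"
        using z by auto
      ultimately show ?thesis unfolding ins_rank_def R' b' by simp
    qed
    moreover have "Min {y \<in> insert (ins xs) (rg xs - {z}). z < y} = ins xs"
    proof (rule Min_eqI)
      fix y assume "y \<in> {y \<in> insert (ins xs) (rg xs - {z}). z < y}"
      then show "ins xs \<le> y" using adj[of y] by force
    qed (use z fR in auto)
    then have "\<psi> (\<phi> xs) = xs"
      unfolding \<psi>_def R' b' by (simp add: \<phi> map_idI)
    ultimately show ?thesis by blast
  qed
  show "inj_on \<phi> {xs \<in> permutations_of_set A. card (rg xs) = s \<and> rank xs = Suc g}"
    by (rule inj_on_inverseI[of _ \<psi>]) (use main in blast)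
  show "\<phi> ` {xs \<in> permutations_of_set A. card (rg xs) = s \<and> rank xs = Suc g}
      \<subseteq> {xs \<in> permutations_of_set A. card (rg xs) = s \<and> rank xs = g}"
    using main by blast
qed (use A in simp)

text \<open>In rank 0 the inserted element is smaller than all of \<open>b_1, ..., b_t\<close>.
  After the exchange with \<open>b_l\<close>, index \<open>l\<close> holds the minimum of these
  \<open>t\<close> elements; so \<open>l\<close> can be read off, the exchange undone, and the
  \<open>t\<close> images are disjoint.\<close>

lemma card_rank_0_le:
  assumes t: "{1..t} \<subseteq> P" "t < j"
  shows "t * card {xs \<in> permutations_of_set A. rank xs = 0} \<le> card (permutations_of_set A)"
proof -
  define E where "E = {xs \<in> permutations_of_set A. rank xs = 0}"
  define \<phi> where "\<phi> = (\<lambda>(l, xs :: 'a list). map (transpose (ins xs) (lower xs ! (l - 1))) xs)"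
  have main: "\<phi> (l, xs) \<in> permutations_of_set A"
      "xs = map (transpose (lower (\<phi> (l, xs)) ! (l - 1)) (lower (\<phi> (l, xs)) ! (j - 1))) (\<phi> (l, xs))"
      "\<And>l'. l' \<in> {1..t} \<Longrightarrow> l' \<noteq> l \<Longrightarrow> lower (\<phi> (l, xs)) ! (l - 1) < lower (\<phi> (l, xs)) ! (l' - 1)"
    if "l \<in> {1..t}" "xs \<in> E" for l xs
  proof -
    have xs: "xs \<in> permutations_of_set A" "rank xs = 0" using that by (auto simp: E_def)
    note pm = perm[OF xs(1)] P(2)
    have fR: "finite (rg xs)" using finite_index_set[OF pm(1,3-5)] by simp
    have bR: "ins xs \<notin> rg xs" using inserted_notin_range[OF pm(1,3-5)] .
    have min: "ins xs < y" if "y \<in> rg xs" for y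
    proof -
      have "{y \<in> rg xs. y < ins xs} = {}" using xs(2) fR by (simp add: ins_rank_def)
      then show ?thesis using that bR by (metis (mono_tags, lifting) empty_iff linorder_neqE mem_Collect_eq)
    qed
    have inR: "lower xs ! (l' - 1) \<in> rg xs" if "l' \<in> {1..t}" for l'
      using that t by (intro lower_prior_in_range[OF pm(1,3-5)]) auto
    let ?c = "lower xs ! (l - 1)"
    have c: "ins xs < ?c" using min[OF inR[OF that(1)]] .
    have \<phi>: "\<phi> (l, xs) = map (transpose (ins xs) ?c) xs" by (simp add: \<phi>_def)
    have low: "lower (\<phi> (l, xs)) = map (transpose (ins xs) ?c) (lower xs)"
      unfolding \<phi> using that t c by (intro swap_lower[OF pm(1,3-5)]) auto
    have lt: "l' - 1 < length (lower xs)" if "l' \<in> {1..t} \<or> l' = j" for l'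
      using that t pm(3) by auto
    show "\<phi> (l, xs) \<in> permutations_of_set A"
      unfolding \<phi> using xs(1) inR[OF that(1)] range_subset_set[OF pm(1,3-5)] inserted_in_set[OF pm(1,3-5)] pm(2)
      by (intro map_transpose_permutations_of_set) auto
    have lj: "lower (\<phi> (l, xs)) ! (j - 1) = ?c" "lower (\<phi> (l, xs)) ! (l - 1) = ins xs"
      using lt[of j] lt[of l] that(1) by (simp_all add: low)
    show "xs = map (transpose (lower (\<phi> (l, xs)) ! (l - 1)) (lower (\<phi> (l, xs)) ! (j - 1))) (\<phi> (l, xs))"
      unfolding lj by (simp add: \<phi> map_idI)
    show "lower (\<phi> (l, xs)) ! (l - 1) < lower (\<phi> (l, xs)) ! (l' - 1)" if l': "l' \<in> {1..t}" "l' \<noteq> l" for l'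
    proof -
      have d: "distinct (lower xs)" using config_upper_lower[OF pm(1)] by (simp add: config_def)
      have "lower xs ! (l' - 1) \<noteq> ?c"
        using d l' \<open>l \<in> {1..t}\<close> t pm(3) by (subst nth_pred_inj) auto
      moreover have "ins xs < lower xs ! (l' - 1)" using min[OF inR[OF l'(1)]] .
      ultimately have "lower (\<phi> (l, xs)) ! (l' - 1) = lower xs ! (l' - 1)"
        using lt[of l'] l' by (auto simp: low transpose_def)
      then show ?thesis using lj \<open>ins xs < lower xs ! (l' - 1)\<close> by simp
    qed
  qed
  have "inj_on \<phi> ({1..t} \<times> E)"
  proof (rule inj_onI, clarify)
    fix l1 xs1 l2 xs2
    assume l: "l1 \<in> {1..t}" "l2 \<in> {1..t}" and x: "xs1 \<in> E" "xs2 \<in> E" and eq: "\<phi> (l1, xs1) = \<phi> (l2, xs2)"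
    have "l1 = l2"
      using main(3)[OF l(1) x(1) l(2)] main(3)[OF l(2) x(2) l(1)] eq by fastforce
    moreover from this have "xs1 = xs2" using main(2)[OF l(1) x(1)] main(2)[OF l(2) x(2)] eq by simp
    ultimately show "l1 = l2 \<and> xs1 = xs2" by simp
  qed
  moreover have "\<phi> ` ({1..t} \<times> E) \<subseteq> permutations_of_set A" using main(1) by auto
  ultimately have "card ({1..t} \<times> E) \<le> card (permutations_of_set A)"
    using A by (intro card_inj_on_le) auto
  then show ?thesis by (simp add: E_def card_cartesian_product)
qed

text \<open>Permutations are grouped by the size \<open>l\<close> of the range and the rank
  \<open>g\<close>. For fixed \<open>l\<close> the counts are antitone in \<open>g\<close>, and the
  number \<open>l + 1\<close> of gaps lies between \<open>j + t\<close> and \<open>S\<close>. The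
  errors at rank 0, added over all \<open>l\<close>, amount to at most \<open>k\<close> times a
  fraction \<open>1 / t\<close> of all permutations.\<close>

lemma sum_ins_cost_le:
  assumes t: "{1..t} \<subseteq> P" "t < j" "t > 0"
    and s: "j + card P \<le> S" "S \<le> 2 ^ k" "2 ^ k \<le> 2 * (j + t)"
  shows "(\<Sum>xs\<in>permutations_of_set A. real (ins_cost (upper xs) (lower xs) P j))
    \<le> (real k + 1 - 2 ^ k / real S + real k / real t) * real (card (permutations_of_set A))"
proof -
  let ?X = "permutations_of_set A"
  define W where "W l g = real (card {xs \<in> ?X. card (rg xs) = l \<and> rank xs = g})" for l g
  let ?K = "real k + 1 - 2 ^ k / real S"
  have bnd: "card (rg xs) \<in> {j - 1 + t..<S}" "rank xs < Suc (card (rg xs))" if "xs \<in> ?X" for xs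
  proof -
    note pm = perm[OF that] P(2)
    have fR: "finite (rg xs)" using finite_index_set[OF pm(1,3-5)] by simp
    show "card (rg xs) \<in> {j - 1 + t..<S}"
      using card_range_le[OF pm(1,3-5)] card_range_ge[OF pm(1,3-5) t(1,2)] s(1) pm(3) by auto
    show "rank xs < Suc (card (rg xs))"
      unfolding ins_rank_def less_Suc_eq_le using fR by (intro card_mono) auto
  qed
  have fX: "finite ?X" using A by simp
  \<comment> \<open>Applied to the cost, to the constant 1 for the total weight, and to the
    indicator of rank 0.\<close>
  have gen: "(\<Sum>xs\<in>?X. F (card (rg xs)) (rank xs)) = (\<Sum>l\<in>{j - 1 + t..<S}. \<Sum>g<Suc l. W l g * F l g)"
    for F :: "nat \<Rightarrow> nat \<Rightarrow> real"
  proof -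
    have "(\<Sum>xs\<in>?X. F (card (rg xs)) (rank xs)) =
        (\<Sum>p\<in>(SIGMA l:{j - 1 + t..<S}. {..<Suc l}). \<Sum>xs\<in>{xs \<in> ?X. (card (rg xs), rank xs) = p}. F (card (rg xs)) (rank xs))"
      using fX bnd by (intro sum.group[symmetric]) auto
    also have "\<dots> = (\<Sum>p\<in>(SIGMA l:{j - 1 + t..<S}. {..<Suc l}). W (fst p) (snd p) * F (fst p) (snd p))"
      by (intro sum.cong refl) (auto simp: W_def)
    also have "\<dots> = (\<Sum>l\<in>{j - 1 + t..<S}. \<Sum>g<Suc l. W l g * F l g)"
      by (subst sum.Sigma) (auto simp: case_prod_beta)
    finally show ?thesis .
  qed
  have "(\<Sum>xs\<in>?X. real (ins_cost (upper xs) (lower xs) P j)) =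
      (\<Sum>l\<in>{j - 1 + t..<S}. \<Sum>g<Suc l. W l g * real (bcost (Suc l) g))"
    unfolding ins_cost_def by (rule gen[of "\<lambda>l g. real (bcost (Suc l) g)"])
  also have "\<dots> \<le> (\<Sum>l\<in>{j - 1 + t..<S}. ?K * (\<Sum>g<Suc l. W l g) + real k * W l 0)"
  proof (rule sum_mono)
    fix l assume l: "l \<in> {j - 1 + t..<S}"
    have "(\<Sum>g<Suc l. W l g * real (bcost (Suc l) g))
        \<le> (real k + 1 - 2 ^ k / real (Suc l)) * (\<Sum>g<Suc l. W l g) + real k * W l 0"
    proof (rule antitone_weighted_bcost_le)
      show "W l (Suc p) \<le> W l p" for p
        unfolding W_def using card_rank_Suc_le[of l p] by simp
    qed (use l s j in \<open>auto simp: W_def\<close>)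
    also have "\<dots> \<le> ?K * (\<Sum>g<Suc l. W l g) + real k * W l 0"
    proof (intro add_right_mono mult_right_mono)
      \<comment> \<open>The mean cost grows with the number of gaps, so the largest number
        \<open>S\<close> serves for all sizes.\<close>
      have "(2::real) ^ k / real S \<le> 2 ^ k / real (Suc l)"
        using l by (intro divide_left_mono) auto
      then show "real k + 1 - 2 ^ k / real (Suc l) \<le> ?K" by simp
    qed (rule sum_nonneg, simp add: W_def)
    finally show "(\<Sum>g<Suc l. W l g * real (bcost (Suc l) g)) \<le> ?K * (\<Sum>g<Suc l. W l g) + real k * W l 0" .
  qed
  also have "\<dots> = ?K * (\<Sum>l\<in>{j - 1 + t..<S}. \<Sum>g<Suc l. W l g) + real k * (\<Sum>l\<in>{j - 1 + t..<S}. W l 0)"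
    by (simp only: sum.distrib sum_distrib_left)
  finally have le: "(\<Sum>xs\<in>?X. real (ins_cost (upper xs) (lower xs) P j))
    \<le> ?K * (\<Sum>l\<in>{j - 1 + t..<S}. \<Sum>g<Suc l. W l g) + real k * (\<Sum>l\<in>{j - 1 + t..<S}. W l 0)" .
  have total: "(\<Sum>l\<in>{j - 1 + t..<S}. \<Sum>g<Suc l. W l g) = real (card ?X)"
    using gen[of "\<lambda>_ _. 1"] by simp
  have zero: "(\<Sum>l\<in>{j - 1 + t..<S}. W l 0) = real (card {xs \<in> ?X. rank xs = 0})"
  proof -
    have "real (card {xs \<in> ?X. rank xs = 0}) = (\<Sum>xs\<in>?X. if rank xs = 0 then 1 else 0)"
      using fX by (simp add: sum.If_cases Int_def)
    also have "\<dots> = (\<Sum>l\<in>{j - 1 + t..<S}. \<Sum>g<Suc l. W l g * (if g = 0 then 1 else 0))"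
      by (rule gen[of "\<lambda>_ g. if g = 0 then 1 else 0"])
    also have "\<dots> = (\<Sum>l\<in>{j - 1 + t..<S}. W l 0)"
      by (intro sum.cong refl) (simp add: sum.lessThan_Suc_shift del: sum.lessThan_Suc)
    finally show ?thesis by simp
  qed
  have "real (card {xs \<in> ?X. rank xs = 0}) \<le> real (card ?X) / real t"
  proof -
    have "real t * real (card {xs \<in> ?X. rank xs = 0}) \<le> real (card ?X)"
      unfolding of_nat_mult[symmetric] of_nat_le_iff using card_rank_0_le[OF t(1,2)] .
    then show ?thesis using t(3) by (simp add: field_simps)
  qed
  then have "real k * real (card {xs \<in> ?X. rank xs = 0}) \<le> real k * (real (card ?X) / real t)"
    by (intro mult_left_mono) auto
  with le[unfolded total zero] have "(\<Sum>xs\<in>?X. real (ins_cost (upper xs) (lower xs) P j))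
      \<le> ?K * real (card ?X) + real k * (real (card ?X) / real t)" by linarith
  then show ?thesis by (simp only: distrib_right times_divide_eq_left times_divide_eq_right)
qed

end

subsection \<open>Averaging over all permutations\<close>

lemma bij_betw_permute_list:
  assumes "distinct ys"
  shows "bij_betw (\<lambda>p. permute_list p ys) {p. p permutes {..<length ys}} (permutations_of_set (set ys))"
proof -
  let ?S = "{p. p permutes {..<length ys}}"
  have inj: "inj_on (\<lambda>p. permute_list p ys) ?S"
  proof (rule inj_onI, rule ext)
    fix p q i
    assume pq: "p \<in> ?S" "q \<in> ?S" and eq: "permute_list p ys = permute_list q ys"
    show "p i = q i"
    proof (cases "i < length ys")
      case True
      then have "ys ! p i = ys ! q i"
        using eq pq by (metis mem_Collect_eq permute_list_nth)
      moreover have "p i < length ys" "q i < length ys"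
        using pq True by (metis lessThan_iff mem_Collect_eq permutes_in_image)+
      ultimately show ?thesis using assms by (simp add: nth_eq_iff_index_eq)
    next
      case False
      then show ?thesis using pq by (auto simp: permutes_not_in)
    qed
  qed
  have "(\<lambda>p. permute_list p ys) ` ?S \<subseteq> permutations_of_set (set ys)"
    using assms by (auto simp: permutations_of_set_def)
  moreover have "card ((\<lambda>p. permute_list p ys) ` ?S) = card (permutations_of_set (set ys))"
    using assms by (simp add: card_image[OF inj] card_permutations distinct_card)
  ultimately have "(\<lambda>p. permute_list p ys) ` ?S = permutations_of_set (set ys)"
    by (intro card_subset_eq) auto
  with inj show ?thesis by (simp add: bij_betw_def)
qed

text \<open>The block permutation of positions induced by \<open>p\<close>: pairs move as a whole
  with their inner order, and a position of an unpaired element is fixed.\<close>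

definition pair_perm :: "nat \<Rightarrow> (nat \<Rightarrow> nat) \<Rightarrow> nat \<Rightarrow> nat" where
  "pair_perm m p q = (if q < 2 * m then 2 * p (q div 2) + q mod 2 else q)"

lemma pair_perm_permutes:
  assumes p: "p permutes {..<m}" and "2 * m \<le> n"
  shows "pair_perm m p permutes {..<n}"
proof (rule inj_imp_permutes)
  have less: "p (q div 2) < m" if "q < 2 * m" for q
    using permutes_in_image[OF p, of "q div 2"] that by auto
  then have less2: "2 * p (q div 2) + q mod 2 < 2 * m" if "q < 2 * m" for q
    using less[OF that] by presburger
  show "inj_on (pair_perm m p) {..<n}"
  proof (rule inj_onI)
    fix x y assume eq: "pair_perm m p x = pair_perm m p y"
    show "x = y"
    proof (cases "x < 2 * m \<and> y < 2 * m")
      case True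
      then have e: "2 * p (x div 2) + x mod 2 = 2 * p (y div 2) + y mod 2"
        using eq by (simp add: pair_perm_def)
      then have "x mod 2 = y mod 2" by presburger
      moreover from this e have "p (x div 2) = p (y div 2)" by simp
      then have "x div 2 = y div 2" using permutes_inj[OF p] by (simp add: inj_eq)
      ultimately show ?thesis by (metis div_mult_mod_eq)
    next
      case False
      then show ?thesis using eq less2[of x] less2[of y] by (auto simp: pair_perm_def split: if_splits)
    qed
  qed
  show "pair_perm m p x \<in> {..<n}" if "x \<in> {..<n}" for x
    using less2[of x] that assms(2) by (auto simp: pair_perm_def)
qed (use assms in \<open>auto simp: pair_perm_def\<close>)

lemma pairs_permute_list:
  assumes p: "p permutes {..<length xs div 2}"
  shows "pairs (permute_list (pair_perm (length xs div 2) p) xs) = permute_list p (pairs xs)"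
proof (rule nth_equalityI)
  let ?m = "length xs div 2"
  fix i assume "i < length (pairs (permute_list (pair_perm ?m p) xs))"
  then have i: "i < ?m" by simp
  have pi: "p i < ?m" using permutes_in_image[OF p, of i] i by simp
  have P: "pair_perm ?m p permutes {..<length xs}" using p by (rule pair_perm_permutes) simp
  have "permute_list (pair_perm ?m p) xs ! (2 * i) = xs ! (2 * p i)"
    "permute_list (pair_perm ?m p) xs ! (2 * i + 1) = xs ! (2 * p i + 1)"
    using i by (subst permute_list_nth[OF P]; simp add: pair_perm_def)+
  then show "pairs (permute_list (pair_perm ?m p) xs) ! i = permute_list p (pairs xs) ! i"
    using i pi p by (simp add: nth_pairs permute_list_nth)
qed simp

text \<open>Permuting the pairs among each other shows that the list of pair maxima is uniformly
  distributed over the orderings of its underlying set.\<close>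
lemma sum_pair_maxima_le:
  fixes A :: "'a::linorder set" and F :: "'a list \<Rightarrow> real"
  assumes A: "finite A"
    and bound: "\<And>M :: 'a set. finite M \<Longrightarrow> card M = card A div 2 \<Longrightarrow>
      (\<Sum>ys\<in>permutations_of_set M. F ys) \<le> C * fact (card M)"
  shows "(\<Sum>xs\<in>permutations_of_set A. F (map fst (pairs xs))) \<le> C * fact (card A)"
proof -
  let ?X = "permutations_of_set A" and ?m = "card A div 2"
  let ?S = "{p. p permutes {..<?m}}"
  define T where "T p xs = permute_list (pair_perm ?m p) xs" for p and xs :: "'a list"
  have len: "length xs = card A" "distinct xs" if "xs \<in> ?X" for xs
    using that by (auto simp: permutations_of_set_def distinct_card)
  have T: "(\<Sum>xs\<in>?X. F (map fst (pairs xs))) = (\<Sum>xs\<in>?X. F (permute_list p (map fst (pairs xs))))"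
    if p: "p \<in> ?S" for p
  proof -
    have P: "pair_perm ?m p permutes {..<card A}" using p by (intro pair_perm_permutes) auto
    have inj: "inj_on (T p) ?X"
    proof (rule inj_on_inverseI[where g = "permute_list (inv (pair_perm ?m p))"])
      fix xs assume "xs \<in> ?X"
      then have l: "length xs = card A" by (rule len)
      have "permute_list (inv (pair_perm ?m p)) (T p xs)
          = permute_list (pair_perm ?m p \<circ> inv (pair_perm ?m p)) xs"
        unfolding T_def using permutes_inv[OF P]
        by (intro permute_list_compose[symmetric]) (simp only: l)
      then show "permute_list (inv (pair_perm ?m p)) (T p xs) = xs"
        unfolding permutes_inv_o(1)[OF P] by simp
    qed
    have sub: "T p ` ?X \<subseteq> ?X"
    proof (rule image_subsetI)
      fix xs assume "xs \<in> ?X"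
      then have "length xs = card A" "distinct xs" "set xs = A"
        by (rule len permutations_of_setD)+
      then show "T p xs \<in> ?X" using P by (simp add: T_def permutations_of_set_def)
    qed
    have "T p ` ?X = ?X" using sub inj by (rule endo_inj_surj[rotated]) simp
    with inj have bij: "bij_betw (T p) ?X ?X" by (simp only: bij_betw_def)
    have "(\<Sum>xs\<in>?X. F (map fst (pairs xs))) = (\<Sum>xs\<in>?X. F (map fst (pairs (T p xs))))"
      using sum.reindex_bij_betw[OF bij, of "\<lambda>xs. F (map fst (pairs xs))"] by simp
    also have "\<dots> = (\<Sum>xs\<in>?X. F (permute_list p (map fst (pairs xs))))"
    proof (rule sum.cong[OF refl])
      fix xs assume "xs \<in> ?X"
      then have l: "length xs = card A" by (rule len)
      then have "pairs (T p xs) = permute_list p (pairs xs)"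
        unfolding T_def using pairs_permute_list[of p xs] p by simp
      then show "F (map fst (pairs (T p xs))) = F (permute_list p (map fst (pairs xs)))"
        using p l by (simp add: permute_list_map)
    qed
    finally show ?thesis .
  qed
  \<comment> \<open>Double counting: for fixed \<open>xs\<close>, letting \<open>p\<close> vary
    produces every ordering of the set of maxima of \<open>xs\<close> once. This set depends on
    \<open>xs\<close>, which is why \<open>bound\<close> is required for all sets \<open>M\<close>
    of that size with the same \<open>C\<close>.\<close>
  have "fact ?m * (\<Sum>xs\<in>?X. F (map fst (pairs xs))) = (\<Sum>p\<in>?S. \<Sum>xs\<in>?X. F (map fst (pairs xs)))"
    by (simp add: card_permutations)
  also have "\<dots> = (\<Sum>p\<in>?S. \<Sum>xs\<in>?X. F (permute_list p (map fst (pairs xs))))"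
    using T by (rule sum.cong[OF refl])
  also have "\<dots> = (\<Sum>xs\<in>?X. \<Sum>p\<in>?S. F (permute_list p (map fst (pairs xs))))"
    by (rule sum.swap)
  also have "\<dots> \<le> (\<Sum>xs\<in>?X. C * fact ?m)"
  proof (rule sum_mono)
    fix xs assume xs: "xs \<in> ?X"
    let ?ys = "map fst (pairs xs)"
    have d: "distinct ?ys" and l: "length ?ys = ?m"
      using len[OF xs] distinct_fst_pairs[of xs] by auto
    have c: "card (set ?ys) = ?m" using distinct_card[OF d] l by simp
    have "(\<Sum>p\<in>?S. F (permute_list p ?ys)) = (\<Sum>zs\<in>permutations_of_set (set ?ys). F zs)"
      using sum.reindex_bij_betw[OF bij_betw_permute_list[OF d], of F] unfolding l .
    also have "\<dots> \<le> C * fact ?m" using bound[of "set ?ys"] unfolding c by blast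
    finally show "(\<Sum>p\<in>?S. F (permute_list p ?ys)) \<le> C * fact ?m" .
  qed
  also have "\<dots> = fact ?m * (C * fact (card A))"
    using A by (simp add: card_permutations_of_set)
  finally show ?thesis by (simp add: mult_le_cancel_left_pos)
qed

section \<open>One insertion phase and the recurrence\<close>

text \<open>Earlier groups enter with their worst case, the last group with its averaged bound. For
  \<open>N = 1\<close> truncated subtraction gives \<open>t = tJ 0 = 1\<close>, and the bound is
  0.\<close>

definition ins_bound :: "nat \<Rightarrow> real" where
  "ins_bound N = (let k = batch N; t = tJ (k - 1) in
     (\<Sum>i = 2..t. real (batch i)) +
     (real N - real t) * (real k + 1 - 2 ^ k / (real N + real t) + real k / real t))"

text \<open>The largest possible number of gaps is constant within a group: in passing from
  \<open>b_j\<close> to \<open>b_{j-1}\<close> the range loses \<open>a_{j-1}\<close> and may gain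
  \<open>b_j\<close>.\<close>

lemma card_prior:
  assumes "2 \<le> j" "j \<le> N"
  shows "j + card (prior N j) = tJ (batch j - 1) + min (tJ (batch j)) N"
proof -
  have "tJ (batch j - 1) < j" using batch_less_iff[of "batch j - 1" j] batch_ge_2[OF assms(1)] by simp
  moreover have "j \<le> tJ (batch j)" using batch_le_iff[of j "batch j"] by simp
  ultimately show ?thesis
    using assms unfolding prior_def by (subst card_Un_disjoint) auto
qed

text \<open>The last two facts confine the number of gaps to the interval from
  \<open>2 ^ (k - 1)\<close> to \<open>2 ^ k\<close> with \<open>k = batch j\<close>, the regime of
  the cost lemmas.\<close>

lemma prior_facts:
  assumes "2 \<le> j" "j \<le> N"
  shows "prior N j \<subseteq> {1..N}" "j \<notin> prior N j" "tJ (batch j - 1) < j"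
    "j + card (prior N j) \<le> 2 ^ batch j" "2 ^ batch j \<le> 2 * (j + tJ (batch j - 1))"
proof -
  have b2: "batch j \<ge> 2" using batch_ge_2[OF assms(1)] .
  show t: "tJ (batch j - 1) < j" using batch_less_iff[of "batch j - 1" j] b2 by simp
  then show "prior N j \<subseteq> {1..N}" "j \<notin> prior N j" using assms by (auto simp: prior_def)
  have sum: "tJ (batch j) + tJ (batch j - 1) = 2 ^ batch j"
    using tJ_Suc[of "batch j - 1"] b2 by simp
  then show "j + card (prior N j) \<le> 2 ^ batch j" using card_prior[OF assms] by simp
  have "tJ (batch j) \<le> 2 * tJ (batch j - 1) + 1"
    using tJ_Suc_double[of "batch j - 1"] b2 by (auto split: if_splits)
  then show "2 ^ batch j \<le> 2 * (j + tJ (batch j - 1))" using sum t by simp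
qed

lemma sum_ins_cost_le_batch:
  fixes A :: "'a::linorder set"
  assumes A: "finite A" and j: "2 \<le> j" "j \<le> (card A + 1) div 2"
  shows "(\<Sum>xs\<in>permutations_of_set A. real (ins_cost (upper xs) (lower xs) (prior ((card A + 1) div 2) j) j))
    \<le> real (batch j) * fact (card A)"
proof -
  let ?P = "prior ((card A + 1) div 2) j"
  note pf = prior_facts[OF j]
  have "ins_cost (upper xs) (lower xs) ?P j \<le> batch j" if "xs \<in> permutations_of_set A" for xs
  proof -
    have xs: "distinct xs" "length xs = card A"
      using that by (auto simp: permutations_of_set_def distinct_card)
    have "card (ins_range (upper xs) (lower xs) ?P j) \<le> j - 1 + card ?P"
      using xs pf(1,2) j by (intro card_range_le) auto
    then show ?thesis unfolding ins_cost_def using pf(4) j by (intro bcost_le) auto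
  qed
  then have "(\<Sum>xs\<in>permutations_of_set A. real (ins_cost (upper xs) (lower xs) ?P j))
      \<le> (\<Sum>xs\<in>permutations_of_set A. real (batch j))"
    by (intro sum_mono) simp
  then show ?thesis using A by (simp add: card_permutations_of_set mult.commute)
qed

lemma sum_insertion_phase_le:
  fixes A :: "'a::linorder set"
  assumes A: "finite A" and N: "N = (card A + 1) div 2" "N \<ge> 1"
  shows "(\<Sum>xs\<in>permutations_of_set A. \<Sum>i = 2..N. real (ins_cost (upper xs) (lower xs) (prior N i) i))
    \<le> ins_bound N * fact (card A)"
proof (cases "N = 1")
  case True
  have "batch 1 = 0" using batch_le_iff[of 1 0] by simp
  then show ?thesis using True by (simp add: ins_bound_def)
next
  case False
  then have N2: "2 \<le> N" using N by simp
  define k where "k = batch N"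
  define t where "t = tJ (k - 1)"
  have k2: "k \<ge> 2" using batch_ge_2[OF N2] by (simp add: k_def)
  have tN: "t < N" using batch_less_iff[of "k - 1" N] k2 by (simp add: t_def k_def)
  have t1: "t \<ge> 1" using tJ_pos[of "k - 1"] by (simp add: t_def)
  have bk: "batch i = k" if "t < i" "i \<le> N" for i
    using that batch_le_iff[of N k] by (intro batch_eqI) (auto simp: t_def k_def)
  have tk: "N \<le> tJ k" using batch_le_iff[of N k] by (simp add: k_def)
  let ?X = "permutations_of_set A"
  let ?c = "\<lambda>i. \<Sum>xs\<in>?X. real (ins_cost (upper xs) (lower xs) (prior N i) i)"
  let ?K = "real k + 1 - 2 ^ k / (real N + real t) + real k / real t"
  have un: "{2..N} = {2..t} \<union> {t<..N}" using tN t1 by auto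
  have "(\<Sum>xs\<in>?X. \<Sum>i = 2..N. real (ins_cost (upper xs) (lower xs) (prior N i) i)) = (\<Sum>i = 2..N. ?c i)"
    by (rule sum.swap)
  also have "\<dots> = (\<Sum>i = 2..t. ?c i) + (\<Sum>i\<in>{t<..N}. ?c i)"
    unfolding un by (rule sum.union_disjoint) auto
  also have "\<dots> \<le> (\<Sum>i = 2..t. real (batch i) * fact (card A)) + (\<Sum>i\<in>{t<..N}. ?K * fact (card A))"
  proof (intro add_mono sum_mono)
    fix i assume "i \<in> {2..t}"
    then show "?c i \<le> real (batch i) * fact (card A)"
      using sum_ins_cost_le_batch[OF A, of i] tN unfolding N(1)[symmetric] by simp
  next
    fix i assume "i \<in> {t<..N}"
    then have i: "t < i" "i \<le> N" "2 \<le> i" using t1 by auto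
    note b = bk[OF i(1,2)]
    note pf = prior_facts[OF i(3,2), unfolded b]
    have "?c i \<le> (real k + 1 - 2 ^ k / real (N + t) + real k / real t) * real (card ?X)"
    proof (rule sum_ins_cost_le[OF A])
      show "i \<in> {1..(card A + 1) div 2}" "prior N i \<subseteq> {1..(card A + 1) div 2}" "i \<notin> prior N i"
        unfolding N(1)[symmetric] using pf i by auto
      show "{1..t} \<subseteq> prior N i" by (auto simp: prior_def b t_def)
      show "t < i" "0 < t" using i t1 by auto
      show "i + card (prior N i) \<le> N + t" using card_prior[OF i(3,2)] tk by (simp add: b t_def)
      show "N + t \<le> 2 ^ k" using tk tJ_Suc[of "k - 1"] k2 by (simp add: t_def)
      show "2 ^ k \<le> 2 * (i + t)" using pf by (simp add: t_def)
    qed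
    then show "?c i \<le> ?K * fact (card A)" using A by (simp add: card_permutations_of_set)
  qed
  also have "\<dots> = ins_bound N * fact (card A)"
    using tN unfolding ins_bound_def Let_def k_def[symmetric] t_def[symmetric]
    by (simp add: sum_distrib_right distrib_right of_nat_diff)
  finally show ?thesis .
qed

fun avg_bound :: "nat \<Rightarrow> real" where
  "avg_bound n = (if n \<le> 1 then 0
     else real (n div 2) + avg_bound (n div 2) + ins_bound ((n + 1) div 2))"

declare avg_bound.simps [simp del]

text \<open>The induction runs over arbitrary finite sets because the recursive call sorts the pair
  maxima, whose set varies with the permutation.\<close>

lemma sum_merge_insertion_le:
  fixes A :: "'a::linorder set"
  assumes "finite A"
  shows "(\<Sum>xs\<in>permutations_of_set A. real (snd (merge_insertion xs))) \<le> avg_bound (card A) * fact (card A)"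
  using assms
proof (induction "card A" arbitrary: A rule: less_induct)
  case less
  let ?X = "permutations_of_set A" and ?n = "card A"
  have len: "length xs = ?n" "distinct xs" if "xs \<in> ?X" for xs
    using that by (auto simp: permutations_of_set_def distinct_card)
  show ?case
  proof (cases "?n \<le> 1")
    case True
    have "snd (merge_insertion xs) = 0" if "xs \<in> ?X" for xs
      using len[OF that] True by (simp add: merge_insertion.simps)
    then show ?thesis using True by (simp add: avg_bound.simps)
  next
    case False
    let ?N = "(?n + 1) div 2"
    have eq: "real (snd (merge_insertion xs)) = real (?n div 2) + real (snd (merge_insertion (map fst (pairs xs)))) +
        (\<Sum>i = 2..?N. real (ins_cost (upper xs) (lower xs) (prior ?N i) i))" if "xs \<in> ?X" for xs
      using snd_merge_insertion[OF len(2)[OF that]] len(1)[OF that] False by simp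
    have "(\<Sum>xs\<in>?X. real (snd (merge_insertion xs))) =
        (\<Sum>xs\<in>?X. real (?n div 2)) + (\<Sum>xs\<in>?X. real (snd (merge_insertion (map fst (pairs xs))))) +
        (\<Sum>xs\<in>?X. \<Sum>i = 2..?N. real (ins_cost (upper xs) (lower xs) (prior ?N i) i))"
      by (simp only: eq sum.distrib cong: sum.cong)
    also have "\<dots> \<le> real (?n div 2) * fact ?n + avg_bound (?n div 2) * fact ?n + ins_bound ?N * fact ?n"
    proof (intro add_mono)
      show "(\<Sum>xs\<in>?X. real (?n div 2)) \<le> real (?n div 2) * fact ?n"
        using less.prems by (simp add: card_permutations_of_set)
      show "(\<Sum>xs\<in>?X. real (snd (merge_insertion (map fst (pairs xs))))) \<le> avg_bound (?n div 2) * fact ?n"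
      proof (rule sum_pair_maxima_le[OF less.prems])
        fix M :: "'a set" assume M: "finite M" "card M = ?n div 2"
        then have "card M < ?n" using False by simp
        from less.hyps[OF this M(1)] M(2)
        show "(\<Sum>ys\<in>permutations_of_set M. real (snd (merge_insertion ys))) \<le> avg_bound (?n div 2) * fact (card M)"
          by simp
      qed
      show "(\<Sum>xs\<in>?X. \<Sum>i = 2..?N. real (ins_cost (upper xs) (lower xs) (prior ?N i) i)) \<le> ins_bound ?N * fact ?n"
        using False by (intro sum_insertion_phase_le[OF less.prems]) auto
    qed
    also have "\<dots> = avg_bound ?n * fact ?n"
      using False by (subst (2) avg_bound.simps) (simp add: algebra_simps)
    finally show ?thesis .
  qed
qed

lemma avg_comparisons_MI_le: "avg_comparisons_MI n \<le> avg_bound n"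
proof -
  have "(\<Sum>xs\<in>permutations_of_set {0..<n}. real (snd (merge_insertion xs))) \<le> avg_bound n * fact n"
    using sum_merge_insertion_le[of "{0..<n}"] by simp
  then show ?thesis by (simp add: avg_comparisons_MI_def card_permutations_of_set field_simps)
qed

subsection \<open>Asymptotic analysis\<close>

text \<open>The rational function is the Pade approximant of type (2, 2) of \<open>ln\<close> at 1.
  Its error has order 5, so the derivative of the difference has the factor \<open>(z - 1)^4\<close>
  and a fixed sign.\<close>

lemma ln_minus_pade_deriv:
  fixes z :: real
  assumes "z > 0"
  shows "((\<lambda>z. ln z - 3 * (z^2 - 1) / (z^2 + 4 * z + 1)) has_real_derivative
    (z - 1)^4 / (z * (z^2 + 4 * z + 1)^2)) (at z)"
proof -
  have E: "z^2 + 4 * z + 1 > 0" using assms by (simp add: add_pos_pos)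
  have "((\<lambda>z. ln z - 3 * (z^2 - 1) / (z^2 + 4 * z + 1)) has_real_derivative
    (1 / z - (3 * (2 * z) * (z^2 + 4 * z + 1) - 3 * (z^2 - 1) * (2 * z + 4)) /
       ((z^2 + 4 * z + 1) * (z^2 + 4 * z + 1)))) (at z)"
    using E assms by (auto intro!: derivative_eq_intros)
  also have "1 / z - (3 * (2 * z) * (z^2 + 4 * z + 1) - 3 * (z^2 - 1) * (2 * z + 4)) /
       ((z^2 + 4 * z + 1) * (z^2 + 4 * z + 1)) =
     ((z^2 + 4 * z + 1)^2 - z * (3 * (2 * z) * (z^2 + 4 * z + 1) - 3 * (z^2 - 1) * (2 * z + 4))) /
       (z * (z^2 + 4 * z + 1)^2)"
    using E assms by (simp add: divide_simps power2_eq_square)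
  also have "(z^2 + 4 * z + 1)^2 - z * (3 * (2 * z) * (z^2 + 4 * z + 1) - 3 * (z^2 - 1) * (2 * z + 4))
      = (z - 1)^4"
    by algebra
  finally show ?thesis .
qed

lemma ln_ge_pade:
  fixes z :: real
  assumes "z \<ge> 1"
  shows "ln z \<ge> 3 * (z^2 - 1) / (z^2 + 4 * z + 1)"
proof -
  let ?h = "\<lambda>z::real. ln z - 3 * (z^2 - 1) / (z^2 + 4 * z + 1)"
  have "?h 1 \<le> ?h z"
  proof (rule DERIV_nonneg_imp_nondecreasing[OF assms])
    fix x :: real assume x: "1 \<le> x" "x \<le> z"
    then show "\<exists>y. (?h has_real_derivative y) (at x) \<and> y \<ge> 0"
      by (intro exI[of _ "(x - 1)^4 / (x * (x^2 + 4 * x + 1)^2)"] conjI ln_minus_pade_deriv) auto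
  qed
  then show ?thesis by simp
qed

text \<open>To the left of 1 the approximant lies above \<open>ln\<close>, so a correction of the
  order of its error is subtracted. The constant is 5 times the lower bound \<open>56 / 5\<close>
  for \<open>x * (x^2 + 4 * x + 1)^2\<close> on the interval from \<open>2 / 3\<close> to 1.\<close>

lemma ln_ge_pade_minus:
  fixes z :: real
  assumes "2 / 3 \<le> z" "z \<le> 1"
  shows "ln z \<ge> 3 * (z^2 - 1) / (z^2 + 4 * z + 1) - (1 - z)^5 / 56"
proof -
  let ?h = "\<lambda>z::real. ln z - 3 * (z^2 - 1) / (z^2 + 4 * z + 1)"
  have "?h z + (1 - z)^5 / 56 \<ge> ?h 1 + (1 - 1)^5 / 56"
  proof (rule DERIV_nonpos_imp_nonincreasing[OF assms(2), of "\<lambda>z. ?h z + (1 - z)^5 / 56"])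
    fix x :: real assume "z \<le> x" "x \<le> 1"
    then have x: "2 / 3 \<le> x" "x > 0" using assms by auto
    have "((\<lambda>z. ?h z + (1 - z)^5 / 56) has_real_derivative
        ((x - 1)^4 / (x * (x^2 + 4 * x + 1)^2) + - (5 * (1 - x)^4) / 56)) (at x)"
      by (rule DERIV_add[OF ln_minus_pade_deriv[OF x(2)]]) (auto intro!: derivative_eq_intros)
    moreover have "(x - 1)^4 / (x * (x^2 + 4 * x + 1)^2) + - (5 * (1 - x)^4) / 56 \<le> 0"
    proof -
      have "x^2 \<ge> (2 / 3)^2" using x by (intro power_mono) auto
      then have "x^2 + 4 * x + 1 \<ge> 37 / 9" using x by (simp add: power2_eq_square)
      then have "(x^2 + 4 * x + 1)^2 \<ge> (37 / 9)^2" by (intro power_mono) auto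
      then have "x * (x^2 + 4 * x + 1)^2 \<ge> 2 / 3 * (37 / 9)^2"
        using x by (intro mult_mono) auto
      then have D: "x * (x^2 + 4 * x + 1)^2 \<ge> 56 / 5" by (simp add: power2_eq_square)
      have "(x - 1)^4 / (x * (x^2 + 4 * x + 1)^2) \<le> (x - 1)^4 / (56 / 5)"
        using D x by (intro divide_left_mono mult_pos_pos) auto
      also have "\<dots> = 5 * (x - 1)^4 / 56" by simp
      finally have "(x - 1)^4 / (x * (x^2 + 4 * x + 1)^2) \<le> 5 * (x - 1)^4 / 56" .
      moreover have "(1 - x)^4 = (x - 1)^4" by algebra
      ultimately show ?thesis by simp
    qed
    ultimately show "\<exists>y. ((\<lambda>z. ?h z + (1 - z)^5 / 56) has_real_derivative y) (at x) \<and> y \<le> 0"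
      by blast
  qed
  then show ?thesis by simp
qed

text \<open>Splitting 2 as \<open>4 / 3 * (3 / 2)\<close> keeps the arguments close to 1, where the
  approximant is precise; the reciprocals \<open>3 / 4\<close> and \<open>2 / 3\<close> give the
  upper bound.\<close>

lemma ln_2_bounds: "ln (2::real) \<in> {693 / 1000..1733 / 2500}"
proof -
  have "ln (2::real) = ln (4 / 3) + ln (3 / 2)" by (subst ln_mult_pos[symmetric]) auto
  moreover have "ln (4 / 3 :: real) = - ln (3 / 4)" "ln (3 / 2 :: real) = - ln (2 / 3)"
    by (simp_all add: ln_div)
  moreover have "ln (4 / 3 :: real) \<ge> 21 / 73" "ln (3 / 2 :: real) \<ge> 15 / 37"
    using ln_ge_pade[of "4 / 3"] ln_ge_pade[of "3 / 2"] by (simp_all add: power2_eq_square)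
  moreover have "ln (3 / 4 :: real) \<ge> - 21 / 73 - 1 / 57344" "ln (2 / 3 :: real) \<ge> - 15 / 37 - 1 / 13608"
    using ln_ge_pade_minus[of "3 / 4"] ln_ge_pade_minus[of "2 / 3"]
    by (simp_all add: eval_nat_numeral)
  ultimately show ?thesis by auto
qed

text \<open>An affine function of \<open>x\<close> is nonnegative once it is so at both ends. With
  \<open>x = ln 2\<close> this leaves polynomial inequalities with rational coefficients.\<close>

lemma linear_between_nonneg:
  fixes x :: real
  assumes "l \<le> x" "x \<le> u" "X - l * Y \<ge> 0" "X - u * Y \<ge> 0"
  shows "X - x * Y \<ge> 0"
proof (cases "Y \<ge> 0")
  case True
  then have "x * Y \<le> u * Y" using assms by (intro mult_right_mono) auto
  then show ?thesis using assms by linarith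
next
  case False
  then have "x * Y \<le> l * Y" using assms by (intro mult_right_mono_neg) auto
  then show ?thesis using assms by linarith
qed

text \<open>The case \<open>z = 1 - w\<close> of the final inequality, cleared of denominators.
  Powers of \<open>w\<close> become independent variables tied by linear constraints, so that linear
  arithmetic settles it.\<close>

lemma key_polynomial_nonneg:
  fixes l w :: real
  assumes l: "l = 693 / 1000 \<or> l = 1733 / 2500" and w: "0 \<le> w" "w \<le> 1 / 3"
  shows "0 \<le> - 30 * w + 33 * w^2 - 9 * w^3 - 15 / 28 * w^5 + 6 / 7 * w^6 - 23 / 56 * w^7 + 3 / 56 * w^8
    - l * (- 3 / 2000 - 53997 / 1250 * w + 863977 / 20000 * w^2 - 143997 / 20000 * w^3)"
proof -
  have linear: "0 \<le> - 30 * w + 33 * w2 - 9 * w3 - 15 / 28 * w5 + 6 / 7 * w6 - 23 / 56 * w7 + 3 / 56 * w8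
      - l * (- 3 / 2000 - 53997 / 1250 * w + 863977 / 20000 * w2 - 143997 / 20000 * w3)"
    if "w3 \<le> w2 / 3" "w4 \<le> w3 / 3" "w5 \<le> w4 / 3" "w7 \<le> w6 / 3" "w6 \<ge> 0" "w8 \<ge> 0"
      "w2 - 47 / 1250 * w + 2209 / 6250000 \<ge> 0"
    for w2 w3 w4 w5 w6 w7 w8 :: real
    using l that w(1) by (elim disjE; hypsubst; simp add: algebra_simps)
  have dec: "w^(Suc n) \<le> w^n / 3" for n
    using mult_right_mono[OF w(2), of "w^n"] w(1) by simp
  \<comment> \<open>Once the negative higher terms are bounded by multiples of \<open>w^2\<close>
    using \<open>w \<le> 1 / 3\<close>, the remaining quadratic for \<open>l = 693 / 1000\<close>
    has its minimum near \<open>47 / 2500\<close>.\<close>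
  have "(w - 47 / 2500)^2 \<ge> 0" by simp
  then have "w^2 - 47 / 1250 * w + 2209 / 6250000 \<ge> 0"
    by (simp add: power2_eq_square algebra_simps)
  then show ?thesis
    using dec[of 2] dec[of 3] dec[of 4] dec[of 6] w(1)
    by (intro linear) (simp_all add: eval_nat_numeral)
qed

text \<open>The minimum over \<open>z\<close> of \<open>log 2 z + 12 / (3 z + 2)\<close> lies near \<open>0.989\<close> and exceeds
  the constant by less than \<open>4 / 10 ^ 5\<close>; this is what limits the theorem to 1.3999.\<close>
lemma ln_ge_key:
  fixes z :: real
  assumes "2 / 3 \<le> z"
  shows "ln z \<ge> ln 2 * (47999 / 20000 - 12 / (3 * z + 2))"
proof -
  define E where "E = z^2 + 4 * z + 1"
  define T where "T = 3 * z + 2"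
  have pos: "E > 0" "T > 0" using assms by (auto simp: E_def T_def add_pos_pos)
  note ln2 = ln_2_bounds[unfolded atLeastAtMost_iff]
  \<comment> \<open>Here \<open>e\<close> is the correction to the approximant, 0 for
    \<open>z \<ge> 1\<close> and \<open>(1 - z)^5 / 56\<close> otherwise. Multiplication by the
    positive \<open>T * E\<close> makes the claim polynomial in \<open>z\<close> and affine in
    \<open>ln 2\<close>.\<close>
  obtain e where lb: "ln z \<ge> 3 * (z^2 - 1) / E - e"
    and poly: "(3 * (z^2 - 1) - e * E) * T - ln 2 * ((47999 / 20000 * T - 12) * E) \<ge> 0"
  proof (cases "z \<ge> 1")
    case True
    define w where "w = z - 1"
    have w: "w \<ge> 0" "z = 1 + w" using True by (auto simp: w_def)
    have "(3 * (z^2 - 1) - 0 * E) * T - ln 2 * ((47999 / 20000 * T - 12) * E) \<ge> 0"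
    proof (rule linear_between_nonneg)
      have X: "(3 * (z^2 - 1) - 0 * E) * T = 30 * w + 33 * w^2 + 9 * w^3"
        unfolding E_def T_def w by algebra
      have Y: "(47999 / 20000 * T - 12) * E = - 3 / 2000 + 53997 / 1250 * w + 863977 / 20000 * w^2 + 143997 / 20000 * w^3"
        unfolding E_def T_def w by (simp add: field_simps power2_eq_square power3_eq_cube)
      have "w^2 \<ge> 0" "w^3 \<ge> 0" using w by auto
      then show "(3 * (z^2 - 1) - 0 * E) * T - 693 / 1000 * ((47999 / 20000 * T - 12) * E) \<ge> 0"
        "(3 * (z^2 - 1) - 0 * E) * T - 1733 / 2500 * ((47999 / 20000 * T - 12) * E) \<ge> 0"
        unfolding X Y using w(1) by (simp_all add: algebra_simps)
    qed (use ln2 in auto)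
    with ln_ge_pade[OF True] show ?thesis using that[of 0] by (simp add: E_def)
  next
    case False
    define w where "w = 1 - z"
    have w: "w \<ge> 0" "w \<le> 1 / 3" "z = 1 - w" using False assms by (auto simp: w_def)
    have "(3 * (z^2 - 1) - w^5 / 56 * E) * T - ln 2 * ((47999 / 20000 * T - 12) * E) \<ge> 0"
    proof (rule linear_between_nonneg)
      have X: "(3 * (z^2 - 1) - w^5 / 56 * E) * T =
          - 30 * w + 33 * w^2 - 9 * w^3 - 15 / 28 * w^5 + 6 / 7 * w^6 - 23 / 56 * w^7 + 3 / 56 * w^8"
        unfolding E_def T_def w by (simp add: field_simps eval_nat_numeral)
      have Y: "(47999 / 20000 * T - 12) * E = - 3 / 2000 - 53997 / 1250 * w + 863977 / 20000 * w^2 - 143997 / 20000 * w^3"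
        unfolding E_def T_def w by (simp add: field_simps power2_eq_square power3_eq_cube)
      show "(3 * (z^2 - 1) - w^5 / 56 * E) * T - 693 / 1000 * ((47999 / 20000 * T - 12) * E) \<ge> 0"
        unfolding X Y using w by (intro key_polynomial_nonneg) auto
      show "(3 * (z^2 - 1) - w^5 / 56 * E) * T - 1733 / 2500 * ((47999 / 20000 * T - 12) * E) \<ge> 0"
        unfolding X Y using w by (intro key_polynomial_nonneg) auto
    qed (use ln2 in auto)
    with ln_ge_pade_minus[of z] show ?thesis
      using that[of "w^5 / 56"] False assms by (simp add: E_def w_def)
  qed
  have "ln 2 * (47999 / 20000 - 12 / T) = ln 2 * ((47999 / 20000 * T - 12) * E) / (T * E)"
    using pos by (simp add: divide_simps)
  also have "\<dots> \<le> (3 * (z^2 - 1) - e * E) * T / (T * E)"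
    using poly pos by (intro divide_right_mono) auto
  also have "\<dots> = 3 * (z^2 - 1) / E - e" using pos by (simp add: divide_simps)
  also have "\<dots> \<le> ln z" by (rule lb)
  finally show ?thesis by (simp add: T_def)
qed

section \<open>Closed estimates for one insertion phase\<close>

lemma three_tJ_bounds: "\<bar>3 * real (tJ k) - 2 ^ Suc k\<bar> \<le> 1"
proof -
  have "(1::nat) \<le> 2 ^ Suc k" by simp
  then have "3 * tJ k \<le> 2 ^ Suc k + 1" "2 ^ Suc k \<le> 3 * tJ k + 1"
    unfolding three_tJ by auto
  then have "real (3 * tJ k) \<le> real (2 ^ Suc k + 1)" "real (2 ^ Suc k) \<le> real (3 * tJ k + 1)"
    by (simp_all only: of_nat_le_iff)
  then show ?thesis by auto
qed

text \<open>Group \<open>j\<close> has about \<open>2 ^ j / 3\<close> elements of cost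
  \<open>j\<close>, and the sum of \<open>j * 2 ^ j\<close> up to \<open>k\<close> is
  \<open>(k - 1) * 2 ^ (k + 1) + 2\<close>. The square absorbs the rounding in the group
  sizes.\<close>

lemma sum_batch_le:
  "k \<ge> 1 \<Longrightarrow> (\<Sum>i = 2..tJ k. real (batch i)) \<le> (real k - 1) * 2 ^ Suc k / 3 + (real k + 1)^2"
proof (induction k rule: dec_induct)
  case base
  then show ?case by simp
next
  case (step k)
  have le: "tJ k \<le> tJ (Suc k)" "tJ k \<ge> 1" using mono_tJ tJ_pos by (auto simp: mono_def)
  then have un: "{2..tJ (Suc k)} = {2..tJ k} \<union> {tJ k<..tJ (Suc k)}" by auto
  have "(\<Sum>i\<in>{tJ k<..tJ (Suc k)}. real (batch i)) = (\<Sum>i\<in>{tJ k<..tJ (Suc k)}. real (Suc k))"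
    by (intro sum.cong refl arg_cong[of _ _ real] batch_eqI) auto
  also have "\<dots> = (real k + 1) * (real (tJ (Suc k)) - real (tJ k))"
    using le by (simp add: of_nat_diff)
  also have "\<dots> \<le> (real k + 1) * (2 ^ Suc k / 3 + 2 / 3)"
  proof (rule mult_left_mono)
    have "real (tJ (Suc k)) + real (tJ k) = 2 ^ Suc k"
      using tJ_Suc[of k] by (metis of_nat_add of_nat_numeral of_nat_power)
    then show "real (tJ (Suc k)) - real (tJ k) \<le> 2 ^ Suc k / 3 + 2 / 3"
      using three_tJ_bounds[of k] by (simp only: abs_le_iff) linarith
  qed simp
  finally have new: "(\<Sum>i\<in>{tJ k<..tJ (Suc k)}. real (batch i)) \<le> (real k + 1) * (2 ^ Suc k / 3 + 2 / 3)" .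
  have "(\<Sum>i = 2..tJ (Suc k). real (batch i)) =
      (\<Sum>i = 2..tJ k. real (batch i)) + (\<Sum>i\<in>{tJ k<..tJ (Suc k)}. real (batch i))"
    unfolding un by (rule sum.union_disjoint) auto
  also have "\<dots> \<le> (real k - 1) * 2 ^ Suc k / 3 + (real k + 1)^2 + (real k + 1) * (2 ^ Suc k / 3 + 2 / 3)"
    using step.IH new by (rule add_mono)
  also have "\<dots> \<le> (real (Suc k) - 1) * 2 ^ Suc (Suc k) / 3 + (real (Suc k) + 1)^2"
    by (simp add: field_simps power2_eq_square)
  finally show ?case .
qed

lemma ins_bound_le_linear:
  assumes N: "N \<ge> 2"
  defines "k \<equiv> batch N"
  shows "ins_bound N \<le> real N * (real k + 1) - real N * (6 * 2 ^ k / (3 * real N + 2 ^ k)) + 2 * (real k + 1)^2"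
    and "2 ^ k \<le> 3 * real N"
proof -
  define t where "t = tJ (k - 1)"
  define K where "K = (2::real) ^ k"
  have k2: "k \<ge> 2" using batch_ge_2[OF N] by (simp add: k_def)
  have tN: "t < N" using batch_less_iff[of "k - 1" N] k2 by (simp add: t_def k_def)
  have Nk: "N \<le> tJ k" using batch_le_iff[of N k] by (simp add: k_def)
  have t1: "t \<ge> 1" using tJ_pos[of "k - 1"] by (simp add: t_def)
  have tK: "\<bar>3 * real t - K\<bar> \<le> 1" using three_tJ_bounds[of "k - 1"] k2 by (simp add: t_def K_def)
  have K: "K \<ge> 4" using power_increasing[OF k2, of "2::real"] by (simp add: K_def)
  have NK: "3 * real N \<ge> K + 2" using tN tK by linarith
  then show "2 ^ k \<le> 3 * real N" by (simp add: K_def)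
  have "tJ k \<le> 2 * t + 1" using tJ_Suc_double[of "k - 1"] k2 by (auto simp: t_def split: if_splits)
  then have Nt: "real N - real t \<le> 2 * real t" using Nk t1 by linarith
  have b1: "(\<Sum>i = 2..t. real (batch i)) \<le> (real k - 2) * K / 3 + (real k)^2"
    using sum_batch_le[of "k - 1"] k2 by (simp add: t_def K_def)
  have b2: "(real N - real t) * (real k + 1) \<le> (real N - K / 3) * (real k + 1) + (real k + 1) / 3"
  proof -
    have "(real N - real t) * (real k + 1) \<le> (real N - K / 3 + 1 / 3) * (real k + 1)"
      using tK by (intro mult_right_mono) auto
    then show ?thesis by (simp add: algebra_simps)
  qed
  \<comment> \<open>The last group has at most \<open>2 * t\<close> elements, so the errors
    \<open>k / t\<close> stay logarithmic in total.\<close>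
  have b3: "(real N - real t) * (real k / real t) \<le> 2 * real k"
    using mult_right_mono[OF Nt, of "real k / real t"] t1 by simp
  \<comment> \<open>The left side equals \<open>K - 2 * K * t / (N + t)\<close> and decreases in
    \<open>t\<close>, so a lower bound needs \<open>t \<le> (K + 1) / 3\<close>; the rounding costs
    at most 1.\<close>
  have b4: "(real N - real t) * (K / (real N + real t)) \<ge> K - 2 * K^2 / (3 * real N + K) - 1"
  proof -
    have "real t / (real N + real t) \<le> (K / 3 + 1 / 3) / (real N + (K / 3 + 1 / 3))"
    proof -
      define s where "s = K / 3 + 1 / 3"
      have "real t \<le> s" "s > 0" using tK K by (auto simp: s_def)
      then have "real t * real N \<le> s * real N" by (intro mult_right_mono) auto
      then have "real t * (real N + s) \<le> s * (real N + real t)" by (simp add: algebra_simps)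
      then have "real t / (real N + real t) \<le> s / (real N + s)"
        using \<open>s > 0\<close> tN by (simp add: divide_simps)
      then show ?thesis by (simp only: s_def)
    qed
    also have "\<dots> \<le> (K / 3 + 1 / 3) / (real N + K / 3)"
      using K tN by (intro divide_left_mono) (auto intro!: mult_pos_pos add_pos_pos)
    also have "\<dots> = (K + 1) / (3 * real N + K)"
      using K tN by (simp add: divide_simps) (simp add: algebra_simps)
    finally have "2 * K * (real t / (real N + real t)) \<le> 2 * K * ((K + 1) / (3 * real N + K))"
      using K by (intro mult_left_mono) auto
    also have "\<dots> = 2 * K^2 / (3 * real N + K) + 2 * K / (3 * real N + K)"
      by (simp add: power2_eq_square algebra_simps add_divide_distrib)
    also have "2 * K / (3 * real N + K) \<le> 1" using NK K by (simp add: divide_simps)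
    finally have le: "2 * K * (real t / (real N + real t)) \<le> 2 * K^2 / (3 * real N + K) + 1" by simp
    have eq: "(real N - real t) * (K / (real N + real t)) = K - 2 * K * (real t / (real N + real t))"
      using tN by (simp add: divide_simps) (simp add: algebra_simps)
    show ?thesis unfolding eq using le by linarith
  qed
  have "ins_bound N = (\<Sum>i = 2..t. real (batch i)) + (real N - real t) * (real k + 1)
      - (real N - real t) * (K / (real N + real t)) + (real N - real t) * (real k / real t)"
    unfolding ins_bound_def Let_def k_def[symmetric] t_def[symmetric] K_def[symmetric]
    by (simp only: distrib_left right_diff_distrib)
  also have "\<dots> \<le> ((real k - 2) * K / 3 + (real k)^2) + ((real N - K / 3) * (real k + 1) + (real k + 1) / 3)
      - (K - 2 * K^2 / (3 * real N + K) - 1) + 2 * real k"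
    using b1 b2 b3 b4 by linarith
  \<comment> \<open>One \<open>K\<close> is the saving in the last group; the other is
    \<open>(k + 1) * K / 3 - (k - 2) * K / 3\<close>, the advantage of the earlier groups over
    \<open>k + 1\<close> per element.\<close>
  also have "\<dots> = real N * (real k + 1) - (2 * K - 2 * K^2 / (3 * real N + K)) + ((real k)^2 + 2 * real k + 1 + (real k + 1) / 3)"
    by (simp add: field_simps)
  also have "2 * K - 2 * K^2 / (3 * real N + K) = real N * (6 * K / (3 * real N + K))"
    using K NK by (simp add: divide_simps) (simp add: algebra_simps power2_eq_square)
  also have "(real k)^2 + 2 * real k + 1 + (real k + 1) / 3 \<le> 2 * (real k + 1)^2"
    by (simp add: power2_eq_square algebra_simps)
  finally show "ins_bound N \<le> real N * (real k + 1) - real N * (6 * 2 ^ k / (3 * real N + 2 ^ k)) + 2 * (real k + 1)^2"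
    by (simp add: K_def)
qed

text \<open>The bound \<open>2 ^ k \<le> 3 * N\<close> puts \<open>z\<close> into the domain of
  \<open>ln_ge_key\<close>, whose constant 2.39995 is \<open>2 + 7999 / 20000\<close>. It also gives
  \<open>k \<le> log 2 N + 2\<close> for the error term.\<close>

lemma ins_bound_le:
  assumes "N \<ge> 1"
  shows "ins_bound N \<le> real N * log 2 (real N) - 7999 / 20000 * real N + 2 * (log 2 (real N) + 3)^2"
proof (cases "N = 1")
  case True
  have "batch 1 = 0" using batch_le_iff[of 1 0] by simp
  then show ?thesis using True by (simp add: ins_bound_def)
next
  case False
  then have N: "N \<ge> 2" using assms by simp
  define k where "k = batch N"
  define z where "z = 2 * real N / 2 ^ k"
  note lin = ins_bound_le_linear[OF N, folded k_def]
  have Npos: "real N > 0" using N by simp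
  have z: "2 / 3 \<le> z" using lin(2) by (simp add: z_def field_simps)
  have "ln z = ln 2 + ln (real N) - real k * ln 2"
    using Npos by (simp add: z_def ln_div ln_mult ln_realpow)
  then have lz: "ln z / ln 2 = 1 + log 2 (real N) - real k"
    by (simp add: log_def field_simps)
  have "ln z / ln 2 \<ge> 47999 / 20000 - 12 / (3 * z + 2)"
    using ln_ge_key[OF z] by (simp add: pos_le_divide_eq mult.commute)
  also have "12 / (3 * z + 2) = 6 * 2 ^ k / (3 * real N + 2 ^ k)"
    using Npos by (simp add: z_def divide_simps)
  finally have "real k + 1 - 6 * 2 ^ k / (3 * real N + 2 ^ k) \<le> log 2 (real N) - 7999 / 20000"
    using lz by linarith
  then have "real N * (real k + 1 - 6 * 2 ^ k / (3 * real N + 2 ^ k)) \<le> real N * (log 2 (real N) - 7999 / 20000)"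
    by (intro mult_left_mono) auto
  then have "real N * (real k + 1) - real N * (6 * 2 ^ k / (3 * real N + 2 ^ k)) \<le>
      real N * log 2 (real N) - 7999 / 20000 * real N"
    by (simp add: right_diff_distrib mult.commute)
  moreover have "2 * (real k + 1)^2 \<le> 2 * (log 2 (real N) + 3)^2"
  proof -
    have "(2::real) ^ k \<le> 4 * real N" using lin(2) Npos by linarith
    then have "log 2 (2 ^ k) \<le> log 2 (2^2 * real N)" using Npos by (subst log_le_cancel_iff) auto
    moreover have "log 2 4 = (2::real)" using log_pow_cancel[of 2 2] by simp
    ultimately have "real k \<le> 2 + log 2 (real N)" using Npos by (simp add: log_mult log_nat_power)
    then show ?thesis by (intro mult_left_mono power_mono) auto
  qed
  ultimately show ?thesis using lin(1) by linarith
qed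

text \<open>The linear terms close up because \<open>27999 / 20000 = 1 + 7999 / 20000\<close>: the
  \<open>- N\<close> from \<open>log N\<close> being about \<open>log n - 1\<close> supplies the 1.
  Squared logarithms over logarithmically many levels give the cube; the factor 20 is
  generous.\<close>

lemma avg_bound_le:
  "n \<ge> 1 \<Longrightarrow> avg_bound n \<le> real n * log 2 (real n) - 27999 / 20000 * real n + 20 * (1 + log 2 (real n))^3"
proof (induction n rule: less_induct)
  case (less n)
  show ?case
  proof (cases "n = 1")
    case True
    then show ?thesis by (simp add: avg_bound.simps)
  next
    case False
    then have n2: "n \<ge> 2" using less.prems by simp
    define m where "m = n div 2"
    define N where "N = (n + 1) div 2"
    define L where "L = log 2 (real n)"
    have mN: "m + N = n" "m \<ge> 1" "N \<ge> 1" "m < n" "2 * real m \<le> real n" "2 * real N \<le> real n + 1"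
      using n2 by (auto simp: m_def N_def)
    have L1: "L \<ge> 1" using n2 by (simp add: L_def le_log_iff)
    have logm: "log 2 (real m) \<le> L - 1"
    proof -
      have "log 2 (real m) \<le> log 2 (real n / 2)" using mN by (subst log_le_cancel_iff) auto
      also have "\<dots> = L - 1" using n2 by (simp add: L_def log_divide)
      finally show ?thesis .
    qed
    have logm0: "log 2 (real m) \<ge> 0" using mN by simp
    \<comment> \<open>For odd \<open>n\<close> the phase has \<open>(n + 1) / 2\<close> elements, so
      \<open>log N\<close> may exceed \<open>L - 1\<close>, but by at most
      \<open>1 / (n * ln 2)\<close>, which costs a constant.\<close>
    have logN: "real N * log 2 (real N) \<le> real N * (L - 1) + 2"
    proof -
      have "real n / 2 * (1 + 1 / real n) = (real n + 1) / 2" using n2 by (simp add: field_simps)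
      moreover have "real N \<le> (real n + 1) / 2" using mN(6) by simp
      ultimately have "real N \<le> real n / 2 * (1 + 1 / real n)" by (simp only:)
      then have "ln (real N) \<le> ln (real n / 2 * (1 + 1 / real n))"
        using mN n2 by (subst ln_le_cancel_iff) (auto intro!: mult_pos_pos add_pos_pos)
      also have "\<dots> = ln (real n / 2) + ln (1 + 1 / real n)"
        using n2 by (intro ln_mult_pos) (auto intro!: add_pos_pos)
      also have "ln (1 + 1 / real n) \<le> 1 / real n" by (intro ln_add_one_self_le_self) simp
      finally have "ln (real N) \<le> ln (real n / 2) + 1 / real n" by simp
      then have "log 2 (real N) \<le> (ln (real n / 2) + 1 / real n) / ln 2"
        unfolding log_def by (intro divide_right_mono) auto
      also have "\<dots> = L - 1 + 1 / (real n * ln 2)"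
        using n2 by (simp add: L_def log_def ln_div field_simps)
      finally have "real N * log 2 (real N) \<le> real N * (L - 1 + 1 / (real n * ln 2))"
        by (intro mult_left_mono) auto
      also have "\<dots> = real N * (L - 1) + real N / (real n * ln 2)" by (simp add: distrib_left)
      also have "real N / (real n * ln 2) \<le> 2"
      proof -
        have "real N \<le> real n * 1" using mN by simp
        also have "\<dots> \<le> real n * (2 * ln 2)" using ln_2_bounds by (intro mult_left_mono) auto
        finally show ?thesis using n2 by (simp add: divide_simps)
      qed
      finally show ?thesis by simp
    qed
    have logN': "log 2 (real N) \<le> L" "log 2 (real N) \<ge> 0"
      using mN by (auto simp: L_def)
    have "avg_bound n = real m + avg_bound m + ins_bound N"
      using n2 by (subst avg_bound.simps) (simp add: m_def N_def)
    also have "\<dots> \<le> real m + (real m * log 2 (real m) - 27999 / 20000 * real m + 20 * (1 + log 2 (real m))^3)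
        + (real N * log 2 (real N) - 7999 / 20000 * real N + 2 * (log 2 (real N) + 3)^2)"
      using less.IH[of m] ins_bound_le[of N] mN by (intro add_mono) auto
    also have "\<dots> \<le> real m + (real m * (L - 1) - 27999 / 20000 * real m + 20 * L^3)
        + (real N * (L - 1) + 2 - 7999 / 20000 * real N + 2 * (L + 3)^2)"
    proof -
      have "real m * log 2 (real m) \<le> real m * (L - 1)" using logm by (intro mult_left_mono) auto
      moreover have "(1 + log 2 (real m))^3 \<le> L^3" using logm logm0 by (intro power_mono) auto
      moreover have "(log 2 (real N) + 3)^2 \<le> (L + 3)^2" using logN' by (intro power_mono) auto
      ultimately show ?thesis using logN by linarith
    qed
    also have "\<dots> = (real m + real N) * L - 27999 / 20000 * (real m + real N) + (20 * L^3 + 2 + 2 * (L + 3)^2)"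
      by (simp add: algebra_simps)
    also have "\<dots> \<le> real n * L - 27999 / 20000 * real n + 20 * (1 + L)^3"
    proof -
      have "real m + real N = real n" using mN by linarith
      moreover have "20 * L^3 + 2 + 2 * (L + 3)^2 \<le> 20 * (1 + L)^3"
      proof -
        have "20 * (1 + L)^3 - (20 * L^3 + 2 + 2 * (L + 3)^2) = 58 * L^2 + 48 * L"
          by algebra
        moreover have "58 * L^2 + 48 * L \<ge> 0" using L1 by simp
        ultimately show ?thesis by linarith
      qed
      ultimately show ?thesis by simp
    qed
    finally show ?thesis by (simp add: L_def)
  qed
qed

theorem theorem6:
  "\<exists>(c :: nat \<Rightarrow> real) (g :: nat \<Rightarrow> real).
     (\<forall>n. c n \<ge> 1.3999) \<and>
     g \<in> O(\<lambda>n. log 2 (real n)) \<and>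
     (\<forall>n. avg_comparisons_MI n = real n * log 2 (real n) - c n * real n + g n)"
proof -
  \<comment> \<open>For large \<open>n\<close> this is the exact coefficient, so that
    \<open>g\<close> vanishes there; the maximum only acts at the remaining arguments.\<close>
  define c where "c n = max 1.3999 (log 2 (real n) - avg_comparisons_MI n / real n)" for n
  define g where "g n = avg_comparisons_MI n - real n * log 2 (real n) + c n * real n" for n
  \<comment> \<open>The slack is \<open>1.39995 - 1.3999\<close>.\<close>
  have "eventually (\<lambda>n. 20 * (1 + log 2 (real n))^3 \<le> 0.00005 * real n) at_top"
    by real_asymp
  then have "eventually (\<lambda>n. g n = 0) at_top"
    using eventually_ge_at_top[of 1]
  proof eventually_elim
    case (elim n)
    have "avg_comparisons_MI n \<le> real n * log 2 (real n) - 1.3999 * real n"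
      using avg_comparisons_MI_le[of n] avg_bound_le[OF elim(2)] elim(1) by simp
    then have "c n = log 2 (real n) - avg_comparisons_MI n / real n"
      using elim(2) by (simp add: c_def field_simps)
    then show ?case using elim(2) by (simp add: g_def field_simps)
  qed
  then have "g \<in> O(\<lambda>n. log 2 (real n))"
    by (intro bigoI[of _ 0]) (auto elim: eventually_mono)
  moreover have "c n \<ge> 1.3999" for n by (simp add: c_def)
  moreover have "avg_comparisons_MI n = real n * log 2 (real n) - c n * real n + g n" for n
    by (simp add: g_def)
  ultimately show ?thesis by blast
qed

end
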